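(* Let $n,m$ be positive integers, let $\lambda\vdash m$ be a partition of $m$, let $\mu=(\mu_1,\ldots,\mu_n)$ be a weak $n$-composition of $m$, and let $I=(1^{\mu_1},2^{\mu_2},\ldots,n^{\mu_n})$ be the corresponding multiset with elements in $\{1,\ldots,n\}$. Then for every matrix $A\in \mathrm{Mat}_n(\mathbb{C})$, $$\frac{\mathrm{Imm}_{\chi^{\lambda}}(A_I)}{m(I)}=\operatorname{tr}\bigl(\mathcal{P}_{\mu}\circ\pi_{\lambda}(A)\circ\mathcal{P}_{\mu}\big|_{U^{\lambda}}\bigr),$$ where $m(I)=\mu_1!\,\mu_2!\cdots\mu_n!$.
   Context: A weak $n$-composition of $m$ is a tuple $\mu=(\mu_1,\ldots,\mu_n)\in\mathbb{Z}_{\ge 0}^n$ with $\mu_1+\cdots+\mu_n=m$. It is identified with the weight $\operatorname{diag}(t_1,\ldots,t_n)\mapsto t_1^{\mu_1}\cdots t_n^{\mu_n}$ of $\mathrm{GL}_n(\mathbb{C})$. The multiset $I=(1^{\mu_1},\ldots,n^{\mu_n})$ contains each $j$ exactly $\mu_j$ times; it is written in weakly increasing order as $(i_1\le\cdots\le i_m)$. For an $n\times n$ matrix $A=(a_{ij})$, the generalized principal submatrix $A_I$ is the $m\times m$ matrix with $(r,s)$ entry $a_{i_r,i_s}$. For $\lambda\vdash m$, $\chi^\lambda$ is the character of the irreducible complex representation of the symmetric group $\mathfrak{S}_m$ indexed by $\lambda$. The $\lambda$-immanant of an $m\times m$ matrix $B=(b_{ij})$ is $$\mathrm{Imm}_{\chi^\lambda}(B)=\sum_{\sigma\in\mathfrak{S}_m}\chi^\lambda(\sigma)\prod_{i=1}^m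 b_{\sigma(i),i}.$$ $(\pi_\lambda,U^\lambda)$ is the irreducible polynomial representation of $\mathrm{GL}_n(\mathbb{C})$ of highest weight $\lambda$, appearing in the Schur–Weyl decomposition of $(\mathbb{C}^n)^{\otimes m}$ as a $\mathrm{GL}_n\times\mathfrak{S}_m$-module; $U^\lambda=0$ if $\lambda$ has more than $n$ parts. Since the matrix entries of $\pi_\lambda$ are polynomials in the entries of the group element, $\pi_\lambda$ extends to all of $\mathrm{Mat}_n(\mathbb{C})$ (equivalently, it is given by the action of $A^{\otimes m}$ on $(\mathbb{C}^n)^{\otimes m}$). $(U^\lambda)_\mu$ is the weight space of $U^\lambda$ of weight $\mu$, and $\mathcal{P}_\mu:U^\lambda\to(U^\lambda)_\mu$ is the projection along the other weight spaces. *)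

theory Defs
  imports
    Complex_Main
    "HOL-Library.Multiset"
    "HOL-Library.Function_Algebras"
    "HOL-Combinatorics.Permutations"
    "Jordan_Normal_Form.Matrix"
begin

text \<open>
  Conventions: indices start at 0, so the symmetric group on \<open>m\<close> letters is
  \<open>{p. p permutes {..<m}}\<close> and the entries of an \<open>n \<times> n\<close> matrix are indexed by \<open>i, j < n\<close>.
  Partitions and weak compositions are lists of natural numbers.
\<close>

section \<open>Complex vector spaces of functions, and traces\<close>

global_interpretation cfun: vector_space "\<lambda>(c :: complex) (f :: 'a \<Rightarrow> complex) x. c * f x"
  by unfold_locales (auto simp: fun_eq_iff algebra_simps)

text \<open>
  The trace of an endomorphism \<open>T\<close> of a finite-dimensional space \<open>V\<close> of functions: the sum of the
  diagonal coefficients of \<open>T\<close> with respect to a basis of \<open>V\<close> (it does not depend on which one).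
\<close>

definition trace_on :: "('a \<Rightarrow> complex) set \<Rightarrow> (('a \<Rightarrow> complex) \<Rightarrow> ('a \<Rightarrow> complex)) \<Rightarrow> complex" where
  "trace_on V T =
     (let B = (SOME B. B \<subseteq> V \<and> cfun.independent B \<and> cfun.span B = V)
      in \<Sum>b\<in>B. cfun.representation B (T b) b)"


section \<open>Partitions, weak compositions, multisets\<close>

definition partition_of :: "nat \<Rightarrow> nat list \<Rightarrow> bool" where
  "partition_of m lam \<longleftrightarrow> sorted_wrt (\<ge>) lam \<and> 0 \<notin> set lam \<and> sum_list lam = m"

definition weak_composition :: "nat \<Rightarrow> nat \<Rightarrow> nat list \<Rightarrow> bool" where
  "weak_composition n m mu \<longleftrightarrow> length mu = n \<and> sum_list mu = m"

definition composition_mset :: "nat list \<Rightarrow> nat multiset" where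
  "composition_mset mu = (\<Sum>j<length mu. replicate_mset (mu ! j) j)"

definition gen_principal_submatrix :: "complex mat \<Rightarrow> nat multiset \<Rightarrow> complex mat" where
  "gen_principal_submatrix A I =
     (let js = sorted_list_of_multiset I
      in mat (size I) (size I) (\<lambda>(r, s). A $$ (js ! r, js ! s)))"


section \<open>Irreducible characters of the symmetric group, and immanants\<close>

text \<open>
  Elements of the group algebra of the symmetric group on \<open>m\<close> letters are functions
  \<open>x :: (nat \<Rightarrow> nat) \<Rightarrow> complex\<close> vanishing outside \<open>{p. p permutes {..<m}}\<close>;
  \<open>x p\<close> is the coefficient of \<open>p\<close>.
\<close>

definition group_algebra :: "nat \<Rightarrow> ((nat \<Rightarrow> nat) \<Rightarrow> complex) set" where
  "group_algebra m = {x. \<forall>p. \<not> p permutes {..<m} \<longrightarrow> x p = 0}"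

definition ga_mult ::
  "nat \<Rightarrow> ((nat \<Rightarrow> nat) \<Rightarrow> complex) \<Rightarrow> ((nat \<Rightarrow> nat) \<Rightarrow> complex) \<Rightarrow> ((nat \<Rightarrow> nat) \<Rightarrow> complex)" where
  "ga_mult m x y = (\<lambda>p. \<Sum>q | q permutes {..<m}. x q * y (inv_into UNIV q \<circ> p))"

text \<open>Left multiplication by the permutation \<open>p\<close>.\<close>

definition ga_left :: "(nat \<Rightarrow> nat) \<Rightarrow> ((nat \<Rightarrow> nat) \<Rightarrow> complex) \<Rightarrow> ((nat \<Rightarrow> nat) \<Rightarrow> complex)" where
  "ga_left p x = (\<lambda>q. x (inv_into UNIV p \<circ> q))"

text \<open>
  The cells (row, column) of the Young diagram in reading order; letter \<open>k\<close> sits in the \<open>k\<close>-th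
  cell, which is the row-reading standard tableau of shape \<open>lam\<close>.
\<close>

definition young_cells :: "nat list \<Rightarrow> (nat \<times> nat) list" where
  "young_cells lam = concat (map (\<lambda>r. map (\<lambda>c. (r, c)) [0..<lam ! r]) [0..<length lam])"

definition row_group :: "nat \<Rightarrow> nat list \<Rightarrow> (nat \<Rightarrow> nat) set" where
  "row_group m lam =
     {p. p permutes {..<m} \<and> (\<forall>k<m. fst (young_cells lam ! p k) = fst (young_cells lam ! k))}"

definition column_group :: "nat \<Rightarrow> nat list \<Rightarrow> (nat \<Rightarrow> nat) set" where
  "column_group m lam =
     {p. p permutes {..<m} \<and> (\<forall>k<m. snd (young_cells lam ! p k) = snd (young_cells lam ! k))}"

definition row_symmetrizer :: "nat \<Rightarrow> nat list \<Rightarrow> ((nat \<Rightarrow> nat) \<Rightarrow> complex)" where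
  "row_symmetrizer m lam = (\<lambda>p. if p \<in> row_group m lam then 1 else 0)"

definition column_antisymmetrizer :: "nat \<Rightarrow> nat list \<Rightarrow> ((nat \<Rightarrow> nat) \<Rightarrow> complex)" where
  "column_antisymmetrizer m lam = (\<lambda>p. if p \<in> column_group m lam then of_int (sign p) else 0)"

definition young_symmetrizer :: "nat \<Rightarrow> nat list \<Rightarrow> ((nat \<Rightarrow> nat) \<Rightarrow> complex)" where
  "young_symmetrizer m lam = ga_mult m (row_symmetrizer m lam) (column_antisymmetrizer m lam)"

text \<open>
  The irreducible representation indexed by \<open>lam\<close>: the Specht module, realised as the left ideal
  generated by the Young symmetrizer. A one-row \<open>lam\<close> gives the trivial representation, a
  one-column \<open>lam\<close> the sign representation.
\<close>

definition specht_module :: "nat \<Rightarrow> nat list \<Rightarrow> ((nat \<Rightarrow> nat) \<Rightarrow> complex) set" where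
  "specht_module m lam = (\<lambda>x. ga_mult m x (young_symmetrizer m lam)) ` group_algebra m"

definition irr_char :: "nat \<Rightarrow> nat list \<Rightarrow> (nat \<Rightarrow> nat) \<Rightarrow> complex" where
  "irr_char m lam p = trace_on (specht_module m lam) (ga_left p)"

definition immanant :: "((nat \<Rightarrow> nat) \<Rightarrow> complex) \<Rightarrow> complex mat \<Rightarrow> complex" where
  "immanant chi B =
     (\<Sum>p | p permutes {..<dim_row B}. chi p * (\<Prod>i<dim_row B. B $$ (p i, i)))"


section \<open>Polynomial representations of the general linear group\<close>

text \<open>
  The \<open>m\<close>-th tensor power of complex \<open>n\<close>-space: a tensor is the function of its coordinates in the
  standard basis, which is indexed by words of length \<open>m\<close> over \<open>{..<n}\<close>.
\<close>

definition index_words :: "nat \<Rightarrow> nat \<Rightarrow> nat list set" where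
  "index_words n m = {w. length w = m \<and> set w \<subseteq> {..<n}}"

definition tensor_space :: "nat \<Rightarrow> nat \<Rightarrow> (nat list \<Rightarrow> complex) set" where
  "tensor_space n m = {f. \<forall>w. w \<notin> index_words n m \<longrightarrow> f w = 0}"

text \<open>
  The \<open>m\<close>-fold tensor power of the matrix \<open>A\<close>, acting on \<open>tensor_space n m\<close>. It is defined for all
  \<open>n \<times> n\<close> matrices, invertible or not.
\<close>

definition tensor_power ::
  "nat \<Rightarrow> nat \<Rightarrow> complex mat \<Rightarrow> (nat list \<Rightarrow> complex) \<Rightarrow> (nat list \<Rightarrow> complex)" where
  "tensor_power n m A f =
     (\<lambda>w. if w \<in> index_words n m
          then \<Sum>v\<in>index_words n m. (\<Prod>k<m. A $$ (w ! k, v ! k)) * f v else 0)"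

text \<open>
  The commuting left action of the group algebra by place permutations: \<open>p\<close> moves the \<open>k\<close>-th tensor
  factor to place \<open>p k\<close>, so the coordinate of the result at the word \<open>w\<close> is the original
  coordinate at the word \<open>w \<circ> p\<close>.
\<close>

definition ga_act ::
  "nat \<Rightarrow> nat \<Rightarrow> ((nat \<Rightarrow> nat) \<Rightarrow> complex) \<Rightarrow> (nat list \<Rightarrow> complex) \<Rightarrow> (nat list \<Rightarrow> complex)" where
  "ga_act n m x f =
     (\<lambda>w. if w \<in> index_words n m
          then \<Sum>p | p permutes {..<m}. x p * f (map (\<lambda>k. w ! p k) [0..<m]) else 0)"

text \<open>
  Weyl's construction of the Schur--Weyl component indexed by \<open>lam\<close>: the image of the Young
  symmetrizer on the tensor space. Up to isomorphism this is the space of homomorphisms of the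
  symmetric group from the Specht module of \<open>lam\<close> to the tensor space, that is, the factor paired
  with that Specht module in the Schur--Weyl decomposition. It is the irreducible polynomial
  representation of highest weight \<open>lam\<close>, and zero if \<open>lam\<close> has more than \<open>n\<close> parts.
  Matrices act on it by restriction of \<open>tensor_power\<close>.
\<close>

definition schur_module :: "nat \<Rightarrow> nat \<Rightarrow> nat list \<Rightarrow> (nat list \<Rightarrow> complex) set" where
  "schur_module n m lam = ga_act n m (young_symmetrizer m lam) ` tensor_space n m"

definition schur_rep ::
  "nat \<Rightarrow> nat \<Rightarrow> nat list \<Rightarrow> complex mat \<Rightarrow> (nat list \<Rightarrow> complex) \<Rightarrow> (nat list \<Rightarrow> complex)" where
  "schur_rep n m lam A u = (if u \<in> schur_module n m lam then tensor_power n m A u else 0)"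

definition weight_space :: "nat \<Rightarrow> nat \<Rightarrow> nat list \<Rightarrow> nat list \<Rightarrow> (nat list \<Rightarrow> complex) set" where
  "weight_space n m lam mu =
     {u \<in> schur_module n m lam.
        \<forall>t. (\<forall>i<n. t i \<noteq> 0) \<longrightarrow>
            schur_rep n m lam (mat_diag n t) u = (\<lambda>w. (\<Prod>i<n. t i ^ (mu ! i)) * u w)}"

text \<open>
  The projection onto the weight space of \<open>mu\<close> along the other weight spaces: the component of
  \<open>u\<close> in \<open>weight_space n m lam mu\<close> for the decomposition of the module into weight spaces.
\<close>

definition weight_projection ::
  "nat \<Rightarrow> nat \<Rightarrow> nat list \<Rightarrow> nat list \<Rightarrow> (nat list \<Rightarrow> complex) \<Rightarrow> (nat list \<Rightarrow> complex)" where
  "weight_projection n m lam mu u =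
     (THE v. v \<in> weight_space n m lam mu \<and>
             u - v \<in> cfun.span (\<Union>nu\<in>{nu. length nu = n \<and> nu \<noteq> mu}. weight_space n m lam nu))"

end

theory Submission
  imports Defs "HOL-Combinatorics.Multiset_Permutations"
begin

text \<open>
  Write \<open>c = a * b\<close> for the Young symmetrizer, \<open>a\<close> being the row symmetrizer and \<open>b\<close> the column
  antisymmetrizer. The Specht module is the left ideal generated by \<open>c\<close>, and the Schur module is
  the image of \<open>c\<close> on the tensor space. Suppose that \<open>d\<close> is a quasi-inverse of \<open>c\<close>: \<open>c * d * c = c\<close>.
  Then \<open>d * c\<close> and \<open>c * d\<close> are idempotents; right multiplication by \<open>d * c\<close> projects the group
  algebra onto the Specht module, and \<open>c * d\<close> projects the tensor space onto the Schur module.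
  A trace on the image of a projection is a trace on the ambient space, which has an evident basis:
  permutations in one case, words in the other. So both sides become explicit sums.

  On the character side (\<open>irr_char_eq_conjugation_sum\<close>) the result is
  \<open>\<chi> g = \<Sum>\<^sub>h (d * c) (h\<inverse> g\<inverse> h)\<close>. Summing over conjugates makes \<open>d * c\<close> and \<open>c * d\<close>
  interchangeable (\<open>conjugation_sum_commute\<close>), and if moreover \<open>c * d\<close> is invariant under inversion
  of permutations, then \<open>\<chi> g = \<Sum>\<^sub>h (c * d) (h\<inverse> g h)\<close>.

  On the representation side (\<open>trace_weight_space\<close>) the weight space of \<open>mu\<close> consists of the
  elements supported on the words in which each letter \<open>j\<close> occurs \<open>mu ! j\<close> times. The projection is
  therefore restriction to these words, and the trace is the sum, over these words \<open>w\<close> and over all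
  permutations \<open>p\<close>, of \<open>(c * d) p \<cdot> \<Prod>\<^sub>k A (w (p k), w k)\<close>.
  Every such \<open>w\<close> is a rearrangement of the sorted word \<open>xs\<close>, and arises from exactly \<open>m(I)\<close>
  permutations \<open>h\<close>; replacing \<open>w\<close> by \<open>xs \<circ> h\<close> and conjugating \<open>p\<close> by \<open>h\<close> turns
  \<open>m(I)\<close> times the trace into the immanant of \<open>A\<^sub>I\<close>.

  The existence of such a \<open>d\<close> (\<open>product_quasi_inverse\<close>) rests only on positivity of the group algebra:
  \<open>a\<close> and \<open>b\<close> are real and self-adjoint, and \<open>b\<close> is an idempotent up to a scalar. The element
  \<open>h = a * b * a\<close> is self-adjoint, so by finite dimension and positivity \<open>h = h * h * q\<close> for some
  polynomial \<open>q\<close> in \<open>h\<close>; then \<open>d = a * q\<close> works, because \<open>c * d = h * q\<close> is a polynomial in \<open>h\<close> and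
  hence invariant under inversion.
\<close>

section \<open>Traces of operators given by a kernel\<close>

definition delta :: "'a \<Rightarrow> 'a \<Rightarrow> complex" where
  "delta s = (\<lambda>x. if x = s then 1 else 0)"

lemma sum_fun_apply: "(\<Sum>s\<in>S. f s) x = (\<Sum>s\<in>S. f s x)"
  for f :: "'b \<Rightarrow> 'a \<Rightarrow> complex"
  by (induction S rule: infinite_finite_induct) (auto simp: plus_fun_apply zero_fun_apply)

lemma finite_support_eq_sum_delta:
  assumes "finite S" and "\<And>x. x \<notin> S \<Longrightarrow> v x = 0"
  shows "v = (\<Sum>s\<in>S. (\<lambda>x. v s * delta s x))"
proof
  fix x
  show "v x = (\<Sum>s\<in>S. (\<lambda>x. v s * delta s x)) x"
    using assms sum.delta'[OF assms(1), of x v]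
    by (simp add: sum_fun_apply delta_def if_distrib cong: if_cong)
qed

lemma finite_support_in_span_delta:
  assumes "finite S" and "\<And>x. x \<notin> S \<Longrightarrow> v x = 0"
  shows "v \<in> cfun.span (delta ` S)"
proof -
  have "(\<Sum>s\<in>S. (\<lambda>x. v s * delta s x)) \<in> cfun.span (delta ` S)"
    by (intro cfun.span_sum cfun.span_scale cfun.span_base imageI)
  then show ?thesis
    using finite_support_eq_sum_delta[OF assms] by simp
qed

text \<open>
  If \<open>T\<close> is written on \<open>V\<close> with a kernel \<open>k\<close> whose columns already lie in \<open>V\<close>, then \<open>k\<close> extends \<open>T\<close> to
  all functions supported on \<open>S\<close>, with image in \<open>V\<close>. Such an extension has the same trace as \<open>T\<close>, and
  its trace in the basis of point masses is the sum of the diagonal of \<open>k\<close>.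
\<close>

lemma trace_on_kernel:
  fixes V :: "('a \<Rightarrow> complex) set" and k :: "'a \<Rightarrow> 'a \<Rightarrow> complex"
  assumes S: "finite S" and supp: "\<And>v x. v \<in> V \<Longrightarrow> x \<notin> S \<Longrightarrow> v x = 0"
    and V: "cfun.subspace V" and k: "\<And>s. s \<in> S \<Longrightarrow> k s \<in> V"
    and T: "\<And>v. v \<in> V \<Longrightarrow> T v = (\<lambda>x. \<Sum>s\<in>S. v s * k s x)"
  shows "trace_on V T = (\<Sum>s\<in>S. k s s)"
proof -
  have "\<exists>B. B \<subseteq> V \<and> cfun.independent B \<and> cfun.span B = V"
    using cfun.maximal_independent_subset[of V] cfun.span_minimal[OF _ V] by (metis subset_antisym)
  note basis = someI_ex[OF this]
  define B where B: "B = (SOME B. B \<subseteq> V \<and> cfun.independent B \<and> cfun.span B = V)"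
  have BV: "B \<subseteq> V" and ind: "cfun.independent B" and span: "cfun.span B = V"
    using basis unfolding B by simp_all
  let ?r = "cfun.representation B"
  have "B \<subseteq> cfun.span (delta ` S)"
  proof
    fix b assume "b \<in> B"
    then have "b \<in> V" by (rule subsetD[OF BV])
    then show "b \<in> cfun.span (delta ` S)"
      by (intro finite_support_in_span_delta[OF S] supp)
  qed
  then have finB: "finite B"
    using cfun.independent_span_bound[OF finite_imageI[OF S] ind] by simp
  have Tb: "?r (T b) b = (\<Sum>s\<in>S. b s * ?r (k s) b)" if "b \<in> B" for b
  proof -
    have "T b = (\<Sum>s\<in>S. (\<lambda>x. b s * k s x))"
      using T[OF subsetD[OF BV that]] by (simp add: fun_eq_iff sum_fun_apply)
    moreover have "(\<lambda>x. b s * k s x) \<in> cfun.span B" if "s \<in> S" for s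
      using cfun.subspace_scale[OF V k[OF that]] span by simp
    ultimately have "?r (T b) b = (\<Sum>s\<in>S. ?r (\<lambda>x. b s * k s x) b)"
      using cfun.representation_sum[OF ind, of S "\<lambda>s x. b s * k s x"] by simp
    also have "\<dots> = (\<Sum>s\<in>S. b s * ?r (k s) b)"
    proof (rule sum.cong[OF refl])
      fix s assume "s \<in> S"
      then have "k s \<in> cfun.span B" using k span by simp
      from cfun.representation_scale[OF ind this, of "b s"]
      show "?r (\<lambda>x. b s * k s x) b = b s * ?r (k s) b" by simp
    qed
    finally show ?thesis .
  qed
  have "trace_on V T = (\<Sum>b\<in>B. ?r (T b) b)"
    unfolding trace_on_def Let_def B ..
  also have "\<dots> = (\<Sum>b\<in>B. \<Sum>s\<in>S. b s * ?r (k s) b)"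
    by (rule sum.cong[OF refl Tb])
  also have "\<dots> = (\<Sum>s\<in>S. \<Sum>b\<in>B. b s * ?r (k s) b)"
    by (rule sum.swap)
  also have "\<dots> = (\<Sum>s\<in>S. k s s)"
  proof (rule sum.cong[OF refl])
    fix s assume "s \<in> S"
    then have "k s \<in> cfun.span B" using k span by simp
    from cfun.sum_representation_eq[OF ind this finB subset_refl]
    have "(\<Sum>b\<in>B. (\<lambda>x. ?r (k s) b * b x)) s = k s s" by (rule fun_cong)
    then show "(\<Sum>b\<in>B. b s * ?r (k s) b) = k s s"
      by (simp only: sum_fun_apply mult.commute)
  qed
  finally show ?thesis .
qed

section \<open>The group algebra and its involutions\<close>

abbreviation perms :: "nat \<Rightarrow> (nat \<Rightarrow> nat) set" where
  "perms m \<equiv> {p. p permutes {..<m}}"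

lemma finite_sym [simp]: "finite (perms m)"
  by (simp add: finite_permutations)

text \<open>
  A name of its own for the inverse permutation, because \<open>inv\<close> is also the notation for inverses
  in group structures.
\<close>

abbreviation pinv :: "(nat \<Rightarrow> nat) \<Rightarrow> nat \<Rightarrow> nat" where
  "pinv p \<equiv> inv_into UNIV p"

lemma permutes_comp_cancel:
  assumes "q permutes S"
  shows "pinv q \<circ> (q \<circ> p) = p" "q \<circ> (pinv q \<circ> p) = p" "(p \<circ> pinv q) \<circ> q = p" "(p \<circ> q) \<circ> pinv q = p"
  using permutes_inverses[OF assms] by (auto simp: fun_eq_iff)

lemma permutes_inv_comp:
  assumes "p permutes S" "q permutes S"
  shows "pinv (p \<circ> q) = pinv q \<circ> pinv p"
  using assms by (simp add: o_inv_distrib permutes_bij)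

lemma sum_perms_left:
  assumes "q permutes {..<m}"
  shows "(\<Sum>p\<in>perms m. f (q \<circ> p)) = (\<Sum>p\<in>perms m. f p)"
  by (rule setum_permutations_compose_left[OF assms, symmetric])

lemma sum_perms_right:
  assumes "q permutes {..<m}"
  shows "(\<Sum>p\<in>perms m. f (p \<circ> q)) = (\<Sum>p\<in>perms m. f p)"
  by (rule sum_permutations_compose_right[OF assms, symmetric])

lemma sum_perms_inv: "(\<Sum>p\<in>perms m. f (pinv p)) = (\<Sum>p\<in>perms m. f p)"
  by (rule sum_permutations_inverse[symmetric])

lemma sum_perms_flip:
  assumes "p permutes {..<m}"
  shows "(\<Sum>q\<in>perms m. f (pinv q \<circ> p)) = (\<Sum>q\<in>perms m. f q)"
  using sum_perms_inv[of "\<lambda>q. f (q \<circ> p)"] sum_perms_right[OF assms, of f] by simp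

lemma ga_mult_assoc: "ga_mult m (ga_mult m x y) z = ga_mult m x (ga_mult m y z)"
proof
  fix p
  have "ga_mult m (ga_mult m x y) z p
      = (\<Sum>r\<in>perms m. \<Sum>q\<in>perms m. x r * y (pinv r \<circ> q) * z (pinv q \<circ> p))"
    unfolding ga_mult_def sum_distrib_right by (rule sum.swap)
  also have "\<dots> = (\<Sum>r\<in>perms m. \<Sum>s\<in>perms m. x r * y s * z (pinv (r \<circ> s) \<circ> p))"
  proof (rule sum.cong[OF refl])
    fix r assume r: "r \<in> perms m"
    then have "(\<Sum>q\<in>perms m. x r * y (pinv r \<circ> q) * z (pinv q \<circ> p)) =
       (\<Sum>s\<in>perms m. x r * y (pinv r \<circ> (r \<circ> s)) * z (pinv (r \<circ> s) \<circ> p))"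
      by (intro sum_perms_left[symmetric]) simp
    moreover have "pinv r \<circ> (r \<circ> s) = s" for s :: "nat \<Rightarrow> nat"
      using r permutes_comp_cancel(1)[of r "{..<m}" s] by simp
    ultimately show "(\<Sum>q\<in>perms m. x r * y (pinv r \<circ> q) * z (pinv q \<circ> p)) =
       (\<Sum>s\<in>perms m. x r * y s * z (pinv (r \<circ> s) \<circ> p))"
      by simp
  qed
  also have "\<dots> = ga_mult m x (ga_mult m y z) p"
    unfolding ga_mult_def sum_distrib_left
  proof (rule sum.cong[OF refl], rule sum.cong[OF refl])
    fix r s assume "r \<in> perms m" "s \<in> perms m"
    then have "pinv (r \<circ> s) = pinv s \<circ> pinv r"
      using permutes_inv_comp[of r "{..<m}" s] by simp
    then show "x r * y s * z (pinv (r \<circ> s) \<circ> p) = x r * (y s * z (pinv s \<circ> (pinv r \<circ> p)))"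
      by (simp add: comp_assoc mult.assoc)
  qed
  finally show "ga_mult m (ga_mult m x y) z p = ga_mult m x (ga_mult m y z) p" .
qed

lemma permutes_comp_iff:
  fixes p q :: "nat \<Rightarrow> nat"
  assumes "q permutes S"
  shows "q \<circ> p permutes S \<longleftrightarrow> p permutes S"
  using permutes_compose[OF _ assms] permutes_compose[OF _ permutes_inv[OF assms], of "q \<circ> p"]
  by (auto simp: permutes_comp_cancel[OF assms])

lemma ga_mult_closed:
  assumes "y \<in> group_algebra m"
  shows "ga_mult m x y \<in> group_algebra m"
  using assms by (auto simp: group_algebra_def ga_mult_def permutes_comp_iff permutes_inv intro!: sum.neutral)

lemma ga_mult_delta_left:
  assumes "p permutes {..<m}"
  shows "ga_mult m (delta p) x = ga_left p x"
proof
  fix r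
  have "ga_mult m (delta p) x r = (\<Sum>q\<in>perms m. if q = p then x (pinv q \<circ> r) else 0)"
    unfolding ga_mult_def delta_def by (intro sum.cong) auto
  then show "ga_mult m (delta p) x r = ga_left p x r"
    using assms by (simp add: ga_left_def)
qed

lemma ga_left_closed:
  assumes "p permutes {..<m}" "x \<in> group_algebra m"
  shows "ga_left p x \<in> group_algebra m"
  using ga_mult_closed[OF assms(2), of "delta p"] by (simp add: ga_mult_delta_left[OF assms(1)])

lemma ga_mult_id_left: "ga_mult m (delta id) x = x"
  using ga_mult_delta_left[OF permutes_id] by (simp add: ga_left_def)

lemma ga_mult_id_right:
  assumes "x \<in> group_algebra m"
  shows "ga_mult m x (delta id) = x"
proof
  fix p
  have "pinv q \<circ> p = id \<longleftrightarrow> q = p" if "q permutes {..<m}" for q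
    using permutes_comp_cancel(2)[OF that, of p] permutes_inv_o[OF that] by auto
  then have "ga_mult m x (delta id) p = (\<Sum>q\<in>perms m. if q = p then x q else 0)"
    unfolding ga_mult_def delta_def by (intro sum.cong) auto
  then show "ga_mult m x (delta id) p = x p"
    using assms by (auto simp: group_algebra_def)
qed

lemma delta_id_closed: "delta id \<in> group_algebra m"
  by (auto simp: group_algebra_def delta_def permutes_id)

lemma ga_mult_add_left: "ga_mult m (x + y) z = ga_mult m x z + ga_mult m y z"
  and ga_mult_add_right: "ga_mult m z (x + y) = ga_mult m z x + ga_mult m z y"
  and ga_mult_diff_left: "ga_mult m (x - y) z = ga_mult m x z - ga_mult m y z"
  and ga_mult_diff_right: "ga_mult m z (x - y) = ga_mult m z x - ga_mult m z y"
  and ga_mult_scale_left: "ga_mult m (\<lambda>p. c * x p) z = (\<lambda>p. c * ga_mult m x z p)"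
  and ga_mult_scale_right: "ga_mult m z (\<lambda>p. c * x p) = (\<lambda>p. c * ga_mult m z x p)"
  and ga_mult_zero_left: "ga_mult m 0 z = 0"
  and ga_mult_zero_right: "ga_mult m z 0 = 0"
  by (simp_all add: ga_mult_def fun_eq_iff plus_fun_apply fun_diff_def zero_fun_apply sum.distrib sum_subtractf
      distrib_left distrib_right left_diff_distrib right_diff_distrib sum_distrib_left mult.left_commute mult.assoc)

lemma subspace_group_algebra: "cfun.subspace (group_algebra m)"
  by (auto simp: cfun.subspace_def group_algebra_def)

text \<open>
  The linear anti-automorphism that inverts permutations. Its composite with \<open>ga_cnj\<close>, the
  coefficientwise conjugation, is the adjoint for the Hermitian form in which the
  permutations are orthonormal. Keeping the two apart has a point: the elements fixed by \<open>ga_star\<close>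
  form a complex subspace. The test for permutations makes the result an element of the group algebra
  whatever the argument is.
\<close>

definition ga_star :: "nat \<Rightarrow> ((nat \<Rightarrow> nat) \<Rightarrow> complex) \<Rightarrow> ((nat \<Rightarrow> nat) \<Rightarrow> complex)" where
  "ga_star m x = (\<lambda>p. if p permutes {..<m} then x (pinv p) else 0)"

definition ga_cnj :: "((nat \<Rightarrow> nat) \<Rightarrow> complex) \<Rightarrow> ((nat \<Rightarrow> nat) \<Rightarrow> complex)" where
  "ga_cnj x = (\<lambda>p. cnj (x p))"

lemma ga_star_mult:
  assumes "x \<in> group_algebra m" "y \<in> group_algebra m"
  shows "ga_star m (ga_mult m x y) = ga_mult m (ga_star m y) (ga_star m x)"
proof
  fix p
  show "ga_star m (ga_mult m x y) p = ga_mult m (ga_star m y) (ga_star m x) p"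
  proof (cases "p permutes {..<m}")
    case True
    have "ga_mult m (ga_star m y) (ga_star m x) p = (\<Sum>q\<in>perms m. y (pinv q) * x (pinv (pinv q \<circ> p)))"
    proof -
      have "pinv q \<circ> p permutes {..<m}" if "q permutes {..<m}" for q
        using permutes_compose[OF True permutes_inv[OF that]] .
      then show ?thesis
        unfolding ga_mult_def ga_star_def by (intro sum.cong) simp_all
    qed
    also have "\<dots> = (\<Sum>q\<in>perms m. y (pinv (p \<circ> q)) * x (pinv (pinv (p \<circ> q) \<circ> p)))"
      by (rule sum_perms_left[OF True, symmetric])
    also have "\<dots> = (\<Sum>q\<in>perms m. x q * y (pinv q \<circ> pinv p))"
    proof (intro sum.cong refl)
      fix q assume "q \<in> perms m"
      then have q: "q permutes {..<m}" by simp
      have "pinv (p \<circ> q) \<circ> p = pinv q"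
        unfolding permutes_inv_comp[OF True q] comp_assoc permutes_inv_o(2)[OF True] by simp
      then have "pinv (pinv (p \<circ> q) \<circ> p) = q"
        by (simp add: permutes_inv_inv[OF q])
      then show "y (pinv (p \<circ> q)) * x (pinv (pinv (p \<circ> q) \<circ> p)) = x q * y (pinv q \<circ> pinv p)"
        using q True by (simp add: permutes_inv_comp)
    qed
    finally show ?thesis using True by (simp add: ga_star_def ga_mult_def)
  next
    case False
    then show ?thesis
      by (auto simp: ga_star_def ga_mult_def permutes_comp_iff permutes_inv)
  qed
qed

lemma ga_star_closed: "ga_star m x \<in> group_algebra m"
  by (auto simp: group_algebra_def ga_star_def)

lemma ga_star_star: "x \<in> group_algebra m \<Longrightarrow> ga_star m (ga_star m x) = x"
  by (auto simp: group_algebra_def ga_star_def fun_eq_iff permutes_inv permutes_inv_inv)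

lemma ga_cnj_mult: "ga_cnj (ga_mult m x y) = ga_mult m (ga_cnj x) (ga_cnj y)"
  by (auto simp: ga_cnj_def ga_mult_def)

lemma ga_cnj_closed: "x \<in> group_algebra m \<Longrightarrow> ga_cnj x \<in> group_algebra m"
  by (auto simp: group_algebra_def ga_cnj_def)

text \<open>
  The coefficient of \<open>x * x\<^sup>\<dagger>\<close> at the identity is \<open>\<Sum>\<^sub>q \<bar>x q\<bar>\<^sup>2\<close>.
\<close>

lemma ga_positive:
  assumes "x \<in> group_algebra m" and "ga_mult m x (ga_star m (ga_cnj x)) = 0"
  shows "x = 0"
proof
  fix p
  have "0 = ga_mult m x (ga_star m (ga_cnj x)) id" by (simp add: assms(2))
  also have "\<dots> = (\<Sum>q\<in>perms m. complex_of_real ((cmod (x q))\<^sup>2))"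
    unfolding ga_mult_def
    by (intro sum.cong) (auto simp: ga_star_def ga_cnj_def permutes_inv permutes_inv_inv complex_norm_square simp del: of_real_power)
  finally have "complex_of_real (\<Sum>q\<in>perms m. (cmod (x q))\<^sup>2) = 0"
    by (simp only: of_real_sum)
  then have "(\<Sum>q\<in>perms m. (cmod (x q))\<^sup>2) = 0"
    by (simp only: of_real_eq_0_iff)
  then have "\<forall>q\<in>perms m. x q = 0"
    by (simp add: sum_nonneg_eq_0_iff)
  then show "x p = 0 p" using assms(1) by (cases "p \<in> perms m") (auto simp: group_algebra_def)
qed

lemma ga_positive_left:
  assumes "x \<in> group_algebra m" and "ga_mult m (ga_star m (ga_cnj x)) x = 0"
  shows "x = 0"
proof -
  let ?y = "ga_star m (ga_cnj x)"
  have "ga_star m (ga_cnj ?y) = x"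
    using ga_star_star[OF assms(1)] assms(1)
    by (auto simp: ga_star_def ga_cnj_def fun_eq_iff group_algebra_def permutes_inv permutes_inv_inv)
  then have "?y = 0" using ga_positive[OF ga_star_closed, of m "ga_cnj x"] assms(2) by simp
  then show ?thesis using \<open>ga_star m (ga_cnj ?y) = x\<close>
    by (auto simp: ga_star_def ga_cnj_def fun_eq_iff)
qed


section \<open>Quasi-inverses of self-adjoint elements\<close>

definition ga_pow :: "nat \<Rightarrow> ((nat \<Rightarrow> nat) \<Rightarrow> complex) \<Rightarrow> nat \<Rightarrow> ((nat \<Rightarrow> nat) \<Rightarrow> complex)" where
  "ga_pow m h j = (ga_mult m h ^^ j) (delta id)"

lemma ga_pow_0 [simp]: "ga_pow m h 0 = delta id"
  and ga_pow_Suc [simp]: "ga_pow m h (Suc j) = ga_mult m h (ga_pow m h j)"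
  by (simp_all add: ga_pow_def)

lemma ga_pow_closed: "h \<in> group_algebra m \<Longrightarrow> ga_pow m h j \<in> group_algebra m"
  by (induction j) (simp_all add: delta_id_closed ga_mult_closed)

lemma ga_pow_add: "ga_pow m h (i + j) = ga_mult m (ga_pow m h i) (ga_pow m h j)"
  by (induction i) (simp_all add: ga_mult_assoc ga_mult_id_left)

lemma ga_pow_commute:
  assumes "h \<in> group_algebra m"
  shows "ga_mult m (ga_pow m h j) h = ga_mult m h (ga_pow m h j)"
  using ga_pow_add[of m h j 1] assms by (simp add: ga_mult_id_right)

lemma ga_mult_sum_right: "ga_mult m z (\<Sum>i\<in>S. f i) = (\<Sum>i\<in>S. ga_mult m z (f i))"
  by (induction S rule: infinite_finite_induct) (simp_all only: sum.infinite sum.empty sum.insert ga_mult_zero_right ga_mult_add_right not_False_eq_True)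

text \<open>
  The powers of \<open>h\<close> live in a finite-dimensional space, so they satisfy a linear relation. Solving it for
  the lowest power that occurs gives the claim. (Two equal powers are already such a relation; this
  case is separate because a set of vectors does not record repetitions.)
\<close>

lemma ga_pow_relation:
  assumes h: "h \<in> group_algebra m"
  obtains k q where "q \<in> cfun.span (range (ga_pow m h))"
    and "ga_pow m h k = ga_mult m (ga_pow m h (Suc k)) q"
proof -
  define N where "N = card (perms m)"
  show thesis
  proof (cases "inj_on (ga_pow m h) {..N}")
    case False
    then obtain i j where ij: "i < j" "ga_pow m h i = ga_pow m h j"
      unfolding inj_on_def by (metis nat_neq_iff)
    then have "j = Suc i + (j - Suc i)" by simp
    then have "ga_pow m h i = ga_mult m (ga_pow m h (Suc i)) (ga_pow m h (j - Suc i))"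
      using ga_pow_add ij(2) by metis
    then show thesis by (rule that[rotated]) (simp add: cfun.span_base)
  next
    case True
    have "card (ga_pow m h ` {..N}) = Suc N"
      using card_image[OF True] by simp
    moreover have "card (delta ` perms m) \<le> N"
      unfolding N_def by (rule card_image_le) simp
    moreover have "ga_pow m h ` {..N} \<subseteq> cfun.span (delta ` perms m)"
    proof
      fix x assume "x \<in> ga_pow m h ` {..N}"
      then have "x \<in> group_algebra m" using ga_pow_closed[OF h] by auto
      then show "x \<in> cfun.span (delta ` perms m)"
        by (intro finite_support_in_span_delta) (auto simp: group_algebra_def)
    qed
    ultimately have "cfun.dependent (ga_pow m h ` {..N})"
      using cfun.independent_span_bound[of "delta ` perms m" "ga_pow m h ` {..N}"] by fastforce
    then obtain u v where v: "v \<in> ga_pow m h ` {..N}" "u v \<noteq> 0"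
      and u: "(\<Sum>v\<in>ga_pow m h ` {..N}. (\<lambda>p. u v * v p)) = 0"
      using cfun.dependent_finite[of "ga_pow m h ` {..N}"] by auto
    define a where "a j = u (ga_pow m h j)" for j
    obtain j where "j \<le> N" "a j \<noteq> 0" using v by (auto simp: a_def)
    (* the lowest power with a non-zero coefficient *)
    define k where "k = (LEAST j. a j \<noteq> 0)"
    have k: "a k \<noteq> 0" unfolding k_def by (rule LeastI[of _ j]) fact
    have kN: "k \<le> N" using Least_le[of "\<lambda>j. a j \<noteq> 0" j] \<open>j \<le> N\<close> \<open>a j \<noteq> 0\<close> unfolding k_def by linarith
    have lt: "a j = 0" if "j < k" for j using not_less_Least[of j] that unfolding k_def by blast
    define q where "q = (\<Sum>j\<in>{Suc k..N}. (\<lambda>p. (- a j / a k) * ga_pow m h (j - Suc k) p))"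
    have "q \<in> cfun.span (range (ga_pow m h))"
      unfolding q_def by (intro cfun.span_sum cfun.span_scale cfun.span_base rangeI)
    moreover have "ga_pow m h k = ga_mult m (ga_pow m h (Suc k)) q"
    proof
      fix p
      have "0 = (\<Sum>j\<in>{..N}. a j * ga_pow m h j p)"
        using fun_cong[OF u, of p] by (simp add: sum_fun_apply sum.reindex[OF True] a_def)
      also have "\<dots> = (\<Sum>j\<in>{k..N}. a j * ga_pow m h j p)"
        using lt by (intro sum.mono_neutral_right) (auto simp: not_le)
      also have "\<dots> = a k * ga_pow m h k p + (\<Sum>j\<in>{Suc k..N}. a j * ga_pow m h j p)"
        by (rule sum.atLeast_Suc_atMost[OF kN])
      finally have "ga_pow m h k p = - (\<Sum>j\<in>{Suc k..N}. a j * ga_pow m h j p) / a k"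
        using k by (simp add: field_simps eq_neg_iff_add_eq_0)
      also have "\<dots> = (\<Sum>j\<in>{Suc k..N}. (- a j / a k) * ga_pow m h j p)"
        by (simp add: sum_divide_distrib sum_negf)
      also have "\<dots> = (\<Sum>j\<in>{Suc k..N}. (- a j / a k) *
                          ga_mult m (ga_pow m h (Suc k)) (ga_pow m h (j - Suc k)) p)"
        by (intro sum.cong refl) (metis atLeastAtMost_iff ga_pow_add le_add_diff_inverse)
      also have "\<dots> = ga_mult m (ga_pow m h (Suc k)) q p"
        unfolding q_def ga_mult_sum_right sum_fun_apply ga_mult_scale_right ..
      finally show "ga_pow m h k p = ga_mult m (ga_pow m h (Suc k)) q p" .
    qed
    ultimately show thesis by (rule that)
  qed
qed

lemma ga_star_zero: "ga_star m 0 = 0"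
  and ga_star_add: "ga_star m (x + y) = ga_star m x + ga_star m y"
  and ga_star_scale: "ga_star m (\<lambda>p. c * x p) = (\<lambda>p. c * ga_star m x p)"
  by (auto simp: ga_star_def fun_eq_iff)

text \<open>
  If \<open>h * h * x = 0\<close>, then \<open>(h * x)\<^sup>\<dagger> * (h * x) = x\<^sup>\<dagger> * h * h * x = 0\<close>, and positivity applies.
\<close>

lemma self_adjoint_cancel:
  assumes h: "h \<in> group_algebra m" "ga_star m h = h" "ga_cnj h = h"
    and x: "x \<in> group_algebra m" and "ga_mult m h (ga_mult m h x) = 0"
  shows "ga_mult m h x = 0"
proof (rule ga_positive_left[OF ga_mult_closed[OF x]])
  have "ga_star m (ga_cnj (ga_mult m h x)) = ga_mult m (ga_star m (ga_cnj x)) h"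
    using h x by (simp add: ga_cnj_mult ga_star_mult ga_cnj_closed)
  then show "ga_mult m (ga_star m (ga_cnj (ga_mult m h x))) (ga_mult m h x) = 0"
    using assms(5) by (simp add: ga_mult_assoc ga_mult_zero_right)
qed

lemma self_adjoint_pow_cancel:
  assumes h: "h \<in> group_algebra m" "ga_star m h = h" "ga_cnj h = h"
    and y: "y \<in> group_algebra m" and "ga_mult m (ga_pow m h k) y = 0"
  shows "ga_mult m h y = 0"
  using assms(5)
proof (induction k)
  case 0
  then show ?case by (simp only: ga_pow_0 ga_mult_id_left ga_mult_zero_right)
next
  case (Suc k)
  show ?case
  proof (cases k)
    case 0
    with Suc.prems show ?thesis by (simp add: ga_mult_id_left ga_mult_id_right[OF h(1)])
  next
    case (Suc l)
    have "ga_mult m h (ga_mult m (ga_pow m h l) y) = 0"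
    proof (rule self_adjoint_cancel[OF h ga_mult_closed[OF y]])
      show "ga_mult m h (ga_mult m h (ga_mult m (ga_pow m h l) y)) = 0"
        using Suc.prems unfolding Suc ga_pow_Suc ga_mult_assoc .
    qed
    then have "ga_mult m (ga_pow m h k) y = 0"
      unfolding Suc ga_pow_Suc ga_mult_assoc .
    then show ?thesis by (rule Suc.IH)
  qed
qed

text \<open>
  Cancelling powers of \<open>h\<close> from a relation \<open>h ^ k = h ^ (k + 1) * q\<close> leaves \<open>h = h * h * q\<close>. The
  conditions on \<open>q\<close> hold for every polynomial in \<open>h\<close>, since they hold for powers of \<open>h\<close> and are linear.
\<close>

lemma self_adjoint_quasi_inverse:
  assumes h: "h \<in> group_algebra m" "ga_star m h = h" "ga_cnj h = h"
  obtains q where "q \<in> group_algebra m" "ga_star m q = q"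
    "ga_mult m h q = ga_mult m q h" "h = ga_mult m h (ga_mult m h q)"
proof -
  obtain k q where q: "q \<in> cfun.span (range (ga_pow m h))"
    and k: "ga_pow m h k = ga_mult m (ga_pow m h (Suc k)) q"
    using ga_pow_relation[OF h(1)] by blast
  have star_pow: "ga_star m (ga_pow m h j) = ga_pow m h j" for j
  proof (induction j)
    case 0
    have "(pinv p = id) = (p = id)" if "p permutes {..<m}" for p
      using permutes_inv_inv[OF that] by (metis inv_id)
    then show ?case by (auto simp: ga_star_def delta_def permutes_id)
  next
    case (Suc j)
    then show ?case using h by (simp add: ga_star_mult ga_pow_closed ga_pow_commute)
  qed
  let ?P = "\<lambda>q. q \<in> group_algebra m \<and> ga_star m q = q \<and> ga_mult m h q = ga_mult m q h"
  have "cfun.subspace (Collect ?P)"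
  proof (rule cfun.subspaceI)
    show "0 \<in> Collect ?P"
      using cfun.subspace_0[OF subspace_group_algebra]
      by (simp only: mem_Collect_eq ga_star_zero ga_mult_zero_left ga_mult_zero_right simp_thms)
    show "x + y \<in> Collect ?P" if "x \<in> Collect ?P" "y \<in> Collect ?P" for x y
      using that cfun.subspace_add[OF subspace_group_algebra, of x m y]
      by (simp only: mem_Collect_eq ga_star_add ga_mult_add_left ga_mult_add_right simp_thms)
    show "(\<lambda>p. c * x p) \<in> Collect ?P" if "x \<in> Collect ?P" for c x
      using that cfun.subspace_scale[OF subspace_group_algebra, of x m c]
      by (simp only: mem_Collect_eq ga_star_scale ga_mult_scale_left ga_mult_scale_right simp_thms)
  qed
  with q have P: "?P q"
  proof (rule cfun.span_induct)
    fix x assume "x \<in> range (ga_pow m h)"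
    then obtain j where "x = ga_pow m h j" by blast
    then show "?P x" using h star_pow[of j] by (simp add: ga_pow_closed ga_pow_commute)
  qed
  let ?y = "delta id - ga_mult m h q"
  have "?y \<in> group_algebra m"
    using P by (intro cfun.subspace_diff[OF subspace_group_algebra] delta_id_closed ga_mult_closed) simp
  moreover have "ga_mult m (ga_pow m h k) ?y = 0"
  proof -
    have "ga_mult m (ga_pow m h k) ?y
        = ga_mult m (ga_pow m h k) (delta id) - ga_mult m (ga_mult m (ga_pow m h k) h) q"
      by (simp only: ga_mult_diff_right ga_mult_assoc)
    also have "\<dots> = ga_pow m h k - ga_mult m (ga_pow m h (Suc k)) q"
      using h by (simp add: ga_pow_commute ga_mult_id_right ga_pow_closed)
    also have "\<dots> = 0"
      unfolding k[symmetric] by (rule diff_self)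
    finally show ?thesis .
  qed
  ultimately have "ga_mult m h ?y = 0" by (rule self_adjoint_pow_cancel[OF h])
  then have "h = ga_mult m h (ga_mult m h q)"
    unfolding ga_mult_diff_right ga_mult_id_right[OF h(1)] by (simp only: right_minus_eq)
  with P that show thesis by blast
qed

text \<open>
  Let \<open>h = a * b * a\<close>, choose \<open>q\<close> with \<open>h = h * h * q\<close>, and put \<open>r = 1 - h * q\<close>, so that \<open>r * h = 0\<close>.
  Then \<open>(r * a * b) * (r * a * b)\<^sup>\<dagger> = r * a * b * b * a * r\<^sup>\<dagger> = \<beta> \<cdot> r * h * r\<^sup>\<dagger> = 0\<close>, so that
  \<open>r * a * b = 0\<close> by positivity; that is, \<open>a * b = h * q * (a * b) = (a * b) * (a * q) * (a * b)\<close>.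
\<close>

lemma product_quasi_inverse:
  assumes a: "a \<in> group_algebra m" "ga_star m a = a" "ga_cnj a = a"
    and b: "b \<in> group_algebra m" "ga_star m b = b" "ga_cnj b = b"
    and bb: "ga_mult m b b = (\<lambda>p. \<beta> * b p)"
  obtains d where "d \<in> group_algebra m"
    and "ga_mult m (ga_mult m (ga_mult m a b) d) (ga_mult m a b) = ga_mult m a b"
    and "ga_star m (ga_mult m (ga_mult m a b) d) = ga_mult m (ga_mult m a b) d"
proof -
  note M = ga_mult_closed
  let ?c = "ga_mult m a b"
  define h where "h = ga_mult m ?c a"
  have h: "h \<in> group_algebra m" "ga_star m h = h" "ga_cnj h = h"
    using a b by (simp_all add: h_def M ga_star_mult ga_cnj_mult) (simp add: ga_mult_assoc)
  obtain q where q: "q \<in> group_algebra m" "ga_star m q = q"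
    "ga_mult m h q = ga_mult m q h" "h = ga_mult m h (ga_mult m h q)"
    using self_adjoint_quasi_inverse[OF h] .
  let ?r = "delta id - ga_mult m h q"
  have r: "?r \<in> group_algebra m"
    using q by (intro cfun.subspace_diff[OF subspace_group_algebra] delta_id_closed ga_mult_closed) simp
  have "ga_mult m (ga_mult m h q) h = ga_mult m h (ga_mult m h q)"
    by (simp only: ga_mult_assoc flip: q(3))
  then have rh: "ga_mult m ?r h = 0"
    unfolding ga_mult_diff_left ga_mult_id_left q(4)[symmetric] by (simp only: diff_self)
  let ?y = "ga_mult m ?r ?c"
  have "?y = 0"
  proof (rule ga_positive)
    show "?y \<in> group_algebra m" using b by (simp add: M)
    have "ga_star m (ga_cnj ?y) = ga_mult m (ga_mult m b a) (ga_star m (ga_cnj ?r))"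
      using a b r by (simp add: ga_cnj_mult ga_star_mult ga_cnj_closed M)
    then have "ga_mult m ?y (ga_star m (ga_cnj ?y)) =
      ga_mult m ?r (ga_mult m a (ga_mult m (ga_mult m b b) (ga_mult m a (ga_star m (ga_cnj ?r)))))"
      by (simp add: ga_mult_assoc)
    also have "\<dots> = (\<lambda>p. \<beta> * ga_mult m (ga_mult m ?r h) (ga_star m (ga_cnj ?r)) p)"
      unfolding bb ga_mult_scale_left ga_mult_scale_right h_def by (simp add: ga_mult_assoc)
    also have "\<dots> = 0"
      unfolding rh ga_mult_zero_left by (simp add: zero_fun_def)
    finally show "ga_mult m ?y (ga_star m (ga_cnj ?y)) = 0" .
  qed
  then have c: "?c = ga_mult m (ga_mult m h q) ?c"
    unfolding ga_mult_diff_left ga_mult_id_left by (simp only: right_minus_eq)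
  have hq: "ga_mult m ?c (ga_mult m a q) = ga_mult m h q"
    by (simp add: h_def ga_mult_assoc)
  show thesis
  proof (rule that[of "ga_mult m a q"])
    show "ga_mult m a q \<in> group_algebra m" using q by (simp add: M)
    show "ga_mult m (ga_mult m ?c (ga_mult m a q)) ?c = ?c"
      unfolding hq using c by (rule sym)
    show "ga_star m (ga_mult m ?c (ga_mult m a q)) = ga_mult m ?c (ga_mult m a q)"
      unfolding hq using h q by (simp add: ga_star_mult)
  qed
qed

section \<open>The Young symmetrizer\<close>

lemma fibre_preserving_inv:
  assumes p: "p permutes {..<m}" and f: "\<forall>k<m. f (p k) = f k"
  shows "\<forall>k<m. f (pinv p k) = f k"
proof (intro allI impI)
  fix k assume "k < m"
  then have "pinv p k < m"
    using permutes_in_image[OF permutes_inv[OF p], of k] by simp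
  then show "f (pinv p k) = f k"
    using f[rule_format, of "pinv p k"] permutes_inverses(1)[OF p] by simp
qed

lemma fibre_preserving_comp:
  assumes p: "p permutes {..<m}" "\<forall>k<m. f (p k) = f k"
    and q: "q permutes {..<m}" "\<forall>k<m. f (q k) = f k"
  shows "\<forall>k<m. f ((q \<circ> p) k) = f k"
  using permutes_in_image[OF p(1)] p(2) q(2) by simp

lemma row_group_inv: "p \<in> row_group m lam \<Longrightarrow> pinv p \<in> row_group m lam"
  using fibre_preserving_inv[of p m "\<lambda>k. fst (young_cells lam ! k)"]
  by (simp add: row_group_def permutes_inv)

lemma column_group_inv: "p \<in> column_group m lam \<Longrightarrow> pinv p \<in> column_group m lam"
  using fibre_preserving_inv[of p m "\<lambda>k. snd (young_cells lam ! k)"]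
  by (simp add: column_group_def permutes_inv)

lemma column_group_comp:
  "p \<in> column_group m lam \<Longrightarrow> q \<in> column_group m lam \<Longrightarrow> q \<circ> p \<in> column_group m lam"
  using fibre_preserving_comp[of p m "\<lambda>k. snd (young_cells lam ! k)" q]
  by (simp add: column_group_def permutes_compose)

lemma column_group_permutes: "p \<in> column_group m lam \<Longrightarrow> p permutes {..<m}"
  by (simp add: column_group_def)

lemma row_group_permutes: "p \<in> row_group m lam \<Longrightarrow> p permutes {..<m}"
  by (simp add: row_group_def)

lemma row_symmetrizer_self_adjoint:
  shows "row_symmetrizer m lam \<in> group_algebra m"
    and "ga_star m (row_symmetrizer m lam) = row_symmetrizer m lam"
    and "ga_cnj (row_symmetrizer m lam) = row_symmetrizer m lam"
proof -
  show "row_symmetrizer m lam \<in> group_algebra m"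
    by (auto simp: group_algebra_def row_symmetrizer_def dest: row_group_permutes)
  have "pinv p \<in> row_group m lam \<longleftrightarrow> p \<in> row_group m lam" if "p permutes {..<m}" for p
    using row_group_inv[of p] row_group_inv[of "pinv p"] permutes_inv_inv[OF that] by auto
  then show "ga_star m (row_symmetrizer m lam) = row_symmetrizer m lam"
    unfolding ga_star_def row_symmetrizer_def by (intro ext) (auto dest: row_group_permutes)
  show "ga_cnj (row_symmetrizer m lam) = row_symmetrizer m lam"
    by (auto simp: ga_cnj_def row_symmetrizer_def)
qed

lemma permutes_permutation: "p permutes {..<m::nat} \<Longrightarrow> permutation p"
  by (auto simp: permutation_permutes)

lemma column_antisymmetrizer_self_adjoint:
  shows "column_antisymmetrizer m lam \<in> group_algebra m"
    and "ga_star m (column_antisymmetrizer m lam) = column_antisymmetrizer m lam"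
    and "ga_cnj (column_antisymmetrizer m lam) = column_antisymmetrizer m lam"
proof -
  show "column_antisymmetrizer m lam \<in> group_algebra m"
    by (auto simp: group_algebra_def column_antisymmetrizer_def dest: column_group_permutes)
  have "pinv p \<in> column_group m lam \<longleftrightarrow> p \<in> column_group m lam" if "p permutes {..<m}" for p
    using column_group_inv[of p] column_group_inv[of "pinv p"] permutes_inv_inv[OF that] by auto
  then show "ga_star m (column_antisymmetrizer m lam) = column_antisymmetrizer m lam"
    unfolding ga_star_def column_antisymmetrizer_def
    by (intro ext) (auto simp: sign_inverse permutes_permutation dest: column_group_permutes)
  show "ga_cnj (column_antisymmetrizer m lam) = column_antisymmetrizer m lam"
    by (auto simp: ga_cnj_def column_antisymmetrizer_def)
qed

text \<open>
  The column antisymmetrizer is the sign character on a subgroup and zero elsewhere.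
\<close>

lemma column_antisymmetrizer_square:
  "ga_mult m (column_antisymmetrizer m lam) (column_antisymmetrizer m lam) =
     (\<lambda>p. of_nat (card (column_group m lam)) * column_antisymmetrizer m lam p)"
proof
  fix p
  let ?b = "column_antisymmetrizer m lam" and ?C = "column_group m lam"
  have b: "?b q * ?b (pinv q \<circ> p) = ?b p" if q: "q \<in> ?C" for q
  proof -
    note qm = column_group_permutes[OF q]
    have iff: "pinv q \<circ> p \<in> ?C \<longleftrightarrow> p \<in> ?C"
      using column_group_comp[OF _ column_group_inv[OF q], of p]
        column_group_comp[OF _ q, of "pinv q \<circ> p"] permutes_comp_cancel(2)[OF qm, of p] by auto
    have "sign q * sign (pinv q \<circ> p) = sign p" if "p \<in> ?C"
    proof -
      note pm = column_group_permutes[OF that]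
      have "sign (q \<circ> (pinv q \<circ> p)) = sign q * sign (pinv q \<circ> p)"
        by (intro sign_compose permutes_permutation[OF qm]
            permutes_permutation[OF permutes_compose[OF pm permutes_inv[OF qm]]])
      then show ?thesis by (simp add: permutes_comp_cancel(2)[OF qm])
    qed
    with q iff show ?thesis
      by (auto simp: column_antisymmetrizer_def simp flip: of_int_mult)
  qed
  have "ga_mult m ?b ?b p = (\<Sum>q\<in>?C. ?b q * ?b (pinv q \<circ> p))"
    unfolding ga_mult_def
    by (rule sum.mono_neutral_right)
       (auto simp: column_antisymmetrizer_def dest: column_group_permutes)
  also have "\<dots> = (\<Sum>q\<in>?C. ?b p)"
    using b by (rule sum.cong[OF refl])
  finally show "ga_mult m ?b ?b p = of_nat (card ?C) * ?b p" by simp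
qed

lemma young_symmetrizer_quasi_inverse:
  obtains d where "d \<in> group_algebra m"
    and "ga_mult m (ga_mult m (young_symmetrizer m lam) d) (young_symmetrizer m lam) = young_symmetrizer m lam"
    and "ga_star m (ga_mult m (young_symmetrizer m lam) d) = ga_mult m (young_symmetrizer m lam) d"
  unfolding young_symmetrizer_def
  by (rule product_quasi_inverse[OF row_symmetrizer_self_adjoint column_antisymmetrizer_self_adjoint
      column_antisymmetrizer_square])

lemma young_symmetrizer_closed: "young_symmetrizer m lam \<in> group_algebra m"
  unfolding young_symmetrizer_def by (intro ga_mult_closed column_antisymmetrizer_self_adjoint)


section \<open>Characters as sums over conjugates\<close>

lemma ga_mult_right_factor:
  assumes p: "p permutes {..<m}"
  shows "ga_mult m y x p = (\<Sum>r\<in>perms m. y (p \<circ> pinv r) * x r)"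
proof -
  have "p \<circ> pinv (pinv q \<circ> p) = q" if q: "q \<in> perms m" for q
  proof -
    have "pinv (pinv q \<circ> p) = pinv p \<circ> q"
      using permutes_inv_comp[of "pinv q" "{..<m}" p] q p by (simp add: permutes_inv permutes_inv_inv)
    then show ?thesis using permutes_comp_cancel(2)[OF p] by simp
  qed
  then show ?thesis
    using sum_perms_flip[OF p, of "\<lambda>r. y (p \<circ> pinv r) * x r"] by (simp add: ga_mult_def)
qed

text \<open>
  Expand \<open>x * y\<close> as \<open>\<Sum>\<^sub>q x q \<cdot> y (q\<inverse> h\<inverse> g h)\<close> and substitute \<open>h \<mapsto> h q\<inverse>\<close>: the sum over all
  conjugates is a trace functional.
\<close>

lemma conjugation_sum_commute:
  assumes g: "g permutes {..<m}"
  shows "(\<Sum>h\<in>perms m. ga_mult m x y (pinv h \<circ> g \<circ> h)) = (\<Sum>h\<in>perms m. ga_mult m y x (pinv h \<circ> g \<circ> h))"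
proof -
  have "(\<Sum>h\<in>perms m. ga_mult m x y (pinv h \<circ> g \<circ> h))
      = (\<Sum>q\<in>perms m. \<Sum>h\<in>perms m. x q * y (pinv q \<circ> (pinv h \<circ> g \<circ> h)))"
    unfolding ga_mult_def by (rule sum.swap)
  also have "\<dots> = (\<Sum>q\<in>perms m. \<Sum>h\<in>perms m. y (pinv h \<circ> g \<circ> h \<circ> pinv q) * x q)"
  proof (rule sum.cong[OF refl])
    fix q assume "q \<in> perms m"
    then have q: "q permutes {..<m}" by simp
    have "(\<Sum>h\<in>perms m. x q * y (pinv q \<circ> (pinv h \<circ> g \<circ> h)))
        = (\<Sum>h\<in>perms m. x q * y (pinv (h \<circ> q) \<circ> g \<circ> ((h \<circ> q) \<circ> pinv q)))"
    proof (rule sum.cong[OF refl])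
      fix h assume "h \<in> perms m"
      then have "pinv (h \<circ> q) = pinv q \<circ> pinv h" "(h \<circ> q) \<circ> pinv q = h"
        using permutes_inv_comp[of h "{..<m}" q] permutes_comp_cancel(4)[OF q, of h] q by simp_all
      then show "x q * y (pinv q \<circ> (pinv h \<circ> g \<circ> h)) = x q * y (pinv (h \<circ> q) \<circ> g \<circ> ((h \<circ> q) \<circ> pinv q))"
        by (simp only: comp_assoc)
    qed
    also have "\<dots> = (\<Sum>h\<in>perms m. x q * y (pinv h \<circ> g \<circ> (h \<circ> pinv q)))"
      by (rule sum_perms_right[OF q])
    finally show "(\<Sum>h\<in>perms m. x q * y (pinv q \<circ> (pinv h \<circ> g \<circ> h)))
        = (\<Sum>h\<in>perms m. y (pinv h \<circ> g \<circ> h \<circ> pinv q) * x q)"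
      by (simp only: comp_assoc mult.commute)
  qed
  also have "\<dots> = (\<Sum>h\<in>perms m. \<Sum>q\<in>perms m. y (pinv h \<circ> g \<circ> h \<circ> pinv q) * x q)"
    by (rule sum.swap)
  also have "\<dots> = (\<Sum>h\<in>perms m. ga_mult m y x (pinv h \<circ> g \<circ> h))"
    using g by (intro sum.cong refl ga_mult_right_factor[symmetric] permutes_compose)
      (auto intro: permutes_inv)
  finally show ?thesis .
qed

lemma subspace_image:
  fixes f :: "('a \<Rightarrow> complex) \<Rightarrow> 'b \<Rightarrow> complex"
  assumes S: "cfun.subspace S" and zero: "f 0 = 0" and add: "\<And>x y. f (x + y) = f x + f y"
    and scale: "\<And>c x. f (\<lambda>p. c * x p) = (\<lambda>p. c * f x p)"
  shows "cfun.subspace (f ` S)"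
proof (rule cfun.subspaceI)
  show "0 \<in> f ` S"
    by (rule image_eqI[where x = 0]) (simp_all only: zero cfun.subspace_0[OF S])
  show "x + y \<in> f ` S" if xy: "x \<in> f ` S" "y \<in> f ` S" for x y
  proof -
    obtain x' y' where "x' \<in> S" "y' \<in> S" "x = f x'" "y = f y'"
      using xy by blast
    then show ?thesis
      by (intro image_eqI[of _ f "x' + y'"]) (simp_all only: add cfun.subspace_add[OF S])
  qed
  show "(\<lambda>p. c * x p) \<in> f ` S" if x: "x \<in> f ` S" for c x
  proof -
    obtain x' where "x' \<in> S" "x = f x'" using x by blast
    then show ?thesis
      by (intro image_eqI[of _ f "\<lambda>p. c * x' p"]) (simp_all only: scale cfun.subspace_scale[OF S])
  qed
qed

lemma subspace_specht_module: "cfun.subspace (specht_module m lam)"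
  unfolding specht_module_def
  by (rule subspace_image[OF subspace_group_algebra ga_mult_zero_left ga_mult_add_left ga_mult_scale_left])

text \<open>
  On the left ideal generated by \<open>c\<close>, left multiplication by \<open>g\<close> agrees with \<open>x \<mapsto> g * x * (d * c)\<close>, and
  this maps the whole group algebra into the ideal. Its diagonal entry at the permutation \<open>s\<close> is
  \<open>(d * c) (s\<inverse> g\<inverse> s)\<close>. Commuting \<open>d\<close> and \<open>c\<close> and using that \<open>c * d\<close> is fixed by inversion
  removes the inverse on \<open>g\<close>.
\<close>

lemma irr_char_eq_conjugation_sum:
  assumes d: "d \<in> group_algebra m"
    and c: "c = young_symmetrizer m lam" and cdc: "ga_mult m (ga_mult m c d) c = c"
    and star: "ga_star m (ga_mult m c d) = ga_mult m c d"
    and g: "g permutes {..<m}"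
  shows "irr_char m lam g = (\<Sum>h\<in>perms m. ga_mult m c d (pinv h \<circ> g \<circ> h))"
proof -
  let ?e = "ga_mult m d c" and ?k = "\<lambda>s p. ga_mult m d c (pinv s \<circ> (pinv g \<circ> p))"
  have k: "?k s = ga_mult m (ga_left g (ga_left s d)) c" if "s permutes {..<m}" for s
  proof -
    have "?k s = ga_left g (ga_left s ?e)"
      by (simp add: ga_left_def)
    also have "\<dots> = ga_mult m (ga_left g (ga_left s d)) c"
      using g that by (simp add: ga_mult_assoc flip: ga_mult_delta_left)
    finally show ?thesis .
  qed
  have "irr_char m lam g = (\<Sum>s\<in>perms m. ?k s s)"
    unfolding irr_char_def
  proof (rule trace_on_kernel[where k = ?k and S = "perms m"])
    show "finite (perms m)" by simp
    show "cfun.subspace (specht_module m lam)" by (rule subspace_specht_module)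
    show "v p = 0" if "v \<in> specht_module m lam" "p \<notin> perms m" for v p
      using that ga_mult_closed[OF young_symmetrizer_closed, of m _ lam]
      by (auto simp: specht_module_def group_algebra_def)
    show "?k s \<in> specht_module m lam" if "s \<in> perms m" for s
      unfolding specht_module_def c[symmetric] using that g d k[of s]
      by (auto intro!: ga_left_closed)
    show "ga_left g v = (\<lambda>p. \<Sum>s\<in>perms m. v s * ?k s p)" if "v \<in> specht_module m lam" for v
    proof -
      obtain y where "v = ga_mult m y c" using \<open>v \<in> _\<close> by (auto simp: specht_module_def c)
      then have "ga_mult m v ?e = v" using cdc by (simp only: ga_mult_assoc)
      then have "ga_left g v = ga_left g (ga_mult m v ?e)" by simp
      then show ?thesis by (simp add: ga_left_def ga_mult_def[of m v])
    qed
  qed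
  also have "\<dots> = (\<Sum>s\<in>perms m. ?e (pinv s \<circ> pinv g \<circ> s))"
    by (simp only: comp_assoc)
  also have "\<dots> = (\<Sum>s\<in>perms m. ga_mult m c d (pinv s \<circ> pinv g \<circ> s))"
    by (rule conjugation_sum_commute[OF permutes_inv[OF g]])
  also have "\<dots> = (\<Sum>s\<in>perms m. ga_mult m c d (pinv s \<circ> g \<circ> s))"
  proof (rule sum.cong[OF refl])
    fix s assume "s \<in> perms m"
    then have s: "s permutes {..<m}" by simp
    have p: "pinv s \<circ> g \<circ> s permutes {..<m}"
      using s g by (intro permutes_compose permutes_inv)
    have "pinv (pinv s \<circ> g \<circ> s) = pinv s \<circ> pinv g \<circ> s"
      using permutes_inv_comp[OF permutes_compose[OF g permutes_inv[OF s]] s]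
        permutes_inv_comp[OF permutes_inv[OF s] g] permutes_inv_inv[OF s] by (simp add: comp_assoc)
    then show "ga_mult m c d (pinv s \<circ> pinv g \<circ> s) = ga_mult m c d (pinv s \<circ> g \<circ> s)"
      using fun_cong[OF star, of "pinv s \<circ> g \<circ> s"] p by (simp add: ga_star_def)
  qed
  finally show ?thesis .
qed

section \<open>The commuting actions on the tensor space\<close>

lemma finite_index_words [simp]: "finite (index_words n m)"
proof -
  have "index_words n m = {w. set w \<subseteq> {..<n} \<and> length w = m}"
    by (auto simp: index_words_def)
  then show ?thesis by (simp add: finite_lists_length_eq)
qed

lemma permute_list_index_words:
  "w \<in> index_words n m \<Longrightarrow> p permutes {..<m} \<Longrightarrow> permute_list p w \<in> index_words n m"
  by (auto simp: index_words_def)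

lemma ga_act_apply:
  assumes "w \<in> index_words n m"
  shows "ga_act n m x f w = (\<Sum>p\<in>perms m. x p * f (permute_list p w))"
  using assms by (simp add: ga_act_def permute_list_def index_words_def)

lemma ga_act_outside: "w \<notin> index_words n m \<Longrightarrow> ga_act n m x f w = 0"
  by (simp add: ga_act_def)

lemma ga_act_mult: "ga_act n m (ga_mult m x y) f = ga_act n m x (ga_act n m y f)"
proof
  fix w
  show "ga_act n m (ga_mult m x y) f w = ga_act n m x (ga_act n m y f) w"
  proof (cases "w \<in> index_words n m")
    case True
    have "ga_act n m (ga_mult m x y) f w
        = (\<Sum>q\<in>perms m. \<Sum>p\<in>perms m. x q * y (pinv q \<circ> p) * f (permute_list p w))"
      unfolding ga_act_apply[OF True] ga_mult_def sum_distrib_right by (rule sum.swap)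
    also have "\<dots> = (\<Sum>q\<in>perms m. x q * ga_act n m y f (permute_list q w))"
    proof (rule sum.cong[OF refl])
      fix q assume "q \<in> perms m"
      then have q: "q permutes {..<m}" by simp
      have "(\<Sum>p\<in>perms m. x q * y (pinv q \<circ> p) * f (permute_list p w))
          = (\<Sum>r\<in>perms m. x q * y (pinv q \<circ> (q \<circ> r)) * f (permute_list (q \<circ> r) w))"
        by (rule sum_perms_left[OF q, symmetric])
      also have "\<dots> = (\<Sum>r\<in>perms m. x q * (y r * f (permute_list r (permute_list q w))))"
      proof (rule sum.cong[OF refl])
        fix r assume "r \<in> perms m"
        then have "permute_list (q \<circ> r) w = permute_list r (permute_list q w)"
          using True by (intro permute_list_compose) (simp add: index_words_def)
        then show "x q * y (pinv q \<circ> (q \<circ> r)) * f (permute_list (q \<circ> r) w) =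
            x q * (y r * f (permute_list r (permute_list q w)))"
          unfolding permutes_comp_cancel(1)[OF q] by simp
      qed
      finally show "(\<Sum>p\<in>perms m. x q * y (pinv q \<circ> p) * f (permute_list p w))
          = x q * ga_act n m y f (permute_list q w)"
        unfolding ga_act_apply[OF permute_list_index_words[OF True q]] sum_distrib_left .
    qed
    finally show ?thesis unfolding ga_act_apply[OF True] .
  qed (simp add: ga_act_outside)
qed

lemma ga_act_add: "ga_act n m x (f + g) = ga_act n m x f + ga_act n m x g"
  and ga_act_scale: "ga_act n m x (\<lambda>w. a * f w) = (\<lambda>w. a * ga_act n m x f w)"
  and ga_act_zero: "ga_act n m x 0 = 0"
  by (simp_all add: ga_act_def fun_eq_iff distrib_left sum.distrib sum_distrib_left mult.left_commute)

lemma tensor_power_ga_act: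
  "tensor_power n m A (ga_act n m x f) = ga_act n m x (tensor_power n m A f)"
proof
  fix w
  show "tensor_power n m A (ga_act n m x f) w = ga_act n m x (tensor_power n m A f) w"
  proof (cases "w \<in> index_words n m")
    case True
    let ?W = "index_words n m" and ?a = "\<lambda>w v. \<Prod>k<m. A $$ (w ! k, v ! k)"
    have lenw: "length w = m" using True by (simp add: index_words_def)
    have "tensor_power n m A (ga_act n m x f) w
       = (\<Sum>v\<in>?W. \<Sum>p\<in>perms m. ?a w v * (x p * f (permute_list p v)))"
      using True by (simp add: tensor_power_def ga_act_apply sum_distrib_left)
    also have "\<dots> = (\<Sum>p\<in>perms m. \<Sum>v\<in>?W. ?a w v * (x p * f (permute_list p v)))"
      by (rule sum.swap)
    also have "\<dots> = (\<Sum>p\<in>perms m. \<Sum>v\<in>?W. x p * (?a (permute_list p w) v * f v))"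
    proof (rule sum.cong[OF refl])
      fix p assume "p \<in> perms m"
      then have p: "p permutes {..<m}" by simp
      show "(\<Sum>v\<in>?W. ?a w v * (x p * f (permute_list p v))) =
        (\<Sum>v\<in>?W. x p * (?a (permute_list p w) v * f v))"
      proof (rule sum.reindex_bij_witness[of _ "permute_list (pinv p)" "permute_list p"])
        fix v assume v: "v \<in> ?W"
        then have len: "length v = m" by (simp add: index_words_def)
        show "permute_list (pinv p) (permute_list p v) = v"
          using permute_list_compose[of "pinv p" v p] len permutes_inv[OF p] permutes_inv_o(1)[OF p] by simp
        show "permute_list p (permute_list (pinv p) v) = v"
          using permute_list_compose[of p v "pinv p"] len p permutes_inv_o(2)[OF p] by simp
        show "permute_list p v \<in> ?W" "permute_list (pinv p) v \<in> ?W"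
          using v p by (simp_all add: permute_list_index_words permutes_inv)
        have "?a (permute_list p w) (permute_list p v) = (\<Prod>k<m. A $$ (w ! p k, v ! p k))"
          using p lenw len by (intro prod.cong refl) (simp add: permute_list_nth)
        also have "\<dots> = ?a w v"
          using prod.permute[OF p, of "\<lambda>k. A $$ (w ! k, v ! k)"] by (simp add: comp_def)
        finally show "x p * (?a (permute_list p w) (permute_list p v) * f (permute_list p v)) =
          ?a w v * (x p * f (permute_list p v))" by simp
      qed
    qed
    also have "\<dots> = ga_act n m x (tensor_power n m A f) w"
      unfolding ga_act_apply[OF True]
      by (intro sum.cong refl) (simp add: tensor_power_def permute_list_index_words[OF True] sum_distrib_left)
    finally show ?thesis .
  qed (simp add: ga_act_outside tensor_power_def)
qed

section \<open>Weight spaces and the projections onto them\<close>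

definition content :: "nat \<Rightarrow> nat list \<Rightarrow> nat list" where
  "content n w = map (count (mset w)) [0..<n]"

definition restrict_content ::
  "nat \<Rightarrow> nat list \<Rightarrow> (nat list \<Rightarrow> complex) \<Rightarrow> (nat list \<Rightarrow> complex)" where
  "restrict_content n nu f = (\<lambda>w. if content n w = nu then f w else 0)"

lemma content_permute_list:
  "w \<in> index_words n m \<Longrightarrow> p permutes {..<m} \<Longrightarrow> content n (permute_list p w) = content n w"
  by (simp add: content_def index_words_def)

lemma length_content [simp]: "length (content n w) = n"
  by (simp add: content_def)

lemma restrict_content_ga_act:
  "restrict_content n nu (ga_act n m x f) = ga_act n m x (restrict_content n nu f)"
proof
  fix w
  show "restrict_content n nu (ga_act n m x f) w = ga_act n m x (restrict_content n nu f) w"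
    by (cases "w \<in> index_words n m")
       (auto simp: restrict_content_def ga_act_apply ga_act_outside content_permute_list)
qed

lemma schur_moduleI: "f \<in> tensor_space n m \<Longrightarrow> ga_act n m (young_symmetrizer m lam) f \<in> schur_module n m lam"
  by (simp add: schur_module_def)

lemma schur_module_outside: "u \<in> schur_module n m lam \<Longrightarrow> w \<notin> index_words n m \<Longrightarrow> u w = 0"
  by (auto simp: schur_module_def ga_act_outside)

lemma subspace_tensor_space: "cfun.subspace (tensor_space n m)"
  by (auto simp: cfun.subspace_def tensor_space_def)

lemma subspace_schur_module: "cfun.subspace (schur_module n m lam)"
  unfolding schur_module_def
  by (rule subspace_image[OF subspace_tensor_space ga_act_zero ga_act_add ga_act_scale])

lemma tensor_power_schur_module:
  assumes "u \<in> schur_module n m lam"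
  shows "tensor_power n m A u \<in> schur_module n m lam"
proof -
  obtain f where "u = ga_act n m (young_symmetrizer m lam) f" using assms by (auto simp: schur_module_def)
  moreover have "tensor_power n m A f \<in> tensor_space n m"
    by (simp add: tensor_space_def tensor_power_def)
  ultimately show ?thesis
    by (simp add: tensor_power_ga_act schur_moduleI)
qed

lemma restrict_content_schur_module:
  assumes "u \<in> schur_module n m lam"
  shows "restrict_content n nu u \<in> schur_module n m lam"
proof -
  obtain f where f: "f \<in> tensor_space n m" and "u = ga_act n m (young_symmetrizer m lam) f"
    using assms by (auto simp: schur_module_def)
  moreover have "restrict_content n nu f \<in> tensor_space n m"
    using f by (simp add: tensor_space_def restrict_content_def)
  ultimately show ?thesis
    by (simp add: restrict_content_ga_act schur_moduleI)
qed


lemma prod_letters_eq_prod_content: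
  fixes t :: "nat \<Rightarrow> complex"
  assumes "set w \<subseteq> {..<n}"
  shows "(\<Prod>k<length w. t (w ! k)) = (\<Prod>i<n. t i ^ (content n w ! i))"
proof -
  have "(\<Prod>k<length w. t (w ! k)) = (\<Prod>i<n. t i ^ count (mset w) i)"
    using assms
  proof (induction w)
    case (Cons a w)
    have "(\<Prod>i<n. t i ^ count (mset (a # w)) i) = (\<Prod>i<n. (if i = a then t i else 1) * t i ^ count (mset w) i)"
      by (intro prod.cong) auto
    also have "\<dots> = t a * (\<Prod>i<n. t i ^ count (mset w) i)"
      using Cons.prems by (simp add: prod.distrib)
    also have "\<dots> = (\<Prod>k<length (a # w). t ((a # w) ! k))"
      using Cons by (simp only: prod.lessThan_Suc_shift length_Cons) simp
    finally show ?case ..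
  qed simp
  also have "\<dots> = (\<Prod>i<n. t i ^ (content n w ! i))"
    by (intro prod.cong) (simp_all add: content_def)
  finally show ?thesis .
qed

lemma tensor_power_diag:
  assumes w: "w \<in> index_words n m"
  shows "tensor_power n m (mat_diag n t) f w = (\<Prod>i<n. t i ^ (content n w ! i)) * f w"
proof -
  have w': "length w = m" "set w \<subseteq> {..<n}" using w by (auto simp: index_words_def)
  have entry: "mat_diag n t $$ (w ! k, v ! k) = (if w ! k = v ! k then t (w ! k) else 0)"
    if "v \<in> index_words n m" "k < m" for v k
  proof -
    have "w ! k < n" "v ! k < n"
      using w that nth_mem[of k w] nth_mem[of k v] by (auto simp: index_words_def subset_iff)
    then show ?thesis by (simp add: mat_diag_def)
  qed
  have "(\<Prod>k<m. mat_diag n t $$ (w ! k, v ! k)) * f v = (if v = w then (\<Prod>k<m. t (w ! k)) * f w else 0)"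
    if v: "v \<in> index_words n m" for v
  proof (cases "v = w")
    case True
    then show ?thesis using entry[OF w] by simp
  next
    case False
    then obtain k where "k < m" "w ! k \<noteq> v ! k"
      using v w by (auto simp: index_words_def list_eq_iff_nth_eq)
    then have "(\<Prod>k<m. mat_diag n t $$ (w ! k, v ! k)) = 0"
      using entry[OF v] by (intro prod_zero bexI[of _ k]) simp_all
    with False show ?thesis by simp
  qed
  then have "tensor_power n m (mat_diag n t) f w
      = (\<Sum>v\<in>index_words n m. if v = w then (\<Prod>k<m. t (w ! k)) * f w else 0)"
    using w by (simp add: tensor_power_def)
  then show ?thesis
    using w prod_letters_eq_prod_content[OF w'(2), of t] w'(1) by simp
qed

text \<open>
  A diagonal matrix multiplies the coordinate at the word \<open>w\<close> by the monomial whose exponents are the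
  letter counts of \<open>w\<close>; distinct exponent vectors give distinct monomials.
\<close>

lemma weight_space_eq:
  assumes nu: "length nu = n"
  shows "weight_space n m lam nu = {u \<in> schur_module n m lam. \<forall>w. u w \<noteq> 0 \<longrightarrow> content n w = nu}"
proof (intro Set.set_eqI iffI)
  fix u assume u: "u \<in> weight_space n m lam nu"
  then have U: "u \<in> schur_module n m lam" by (simp add: weight_space_def)
  have "content n w = nu" if nz: "u w \<noteq> 0" for w
  proof (rule nth_equalityI)
    fix i assume "i < length (content n w)"
    then have i: "i < n" by simp
    have w: "w \<in> index_words n m" using schur_module_outside[OF U] nz by blast
    (* A diagonal matrix with one entry 2, which is not a root of unity, reads off a single exponent. *)
    let ?t = "\<lambda>j. if j = i then 2 else (1::complex)"
    have "?t j \<noteq> 0" for j by simp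
    then have "schur_rep n m lam (mat_diag n ?t) u = (\<lambda>w. (\<Prod>j<n. ?t j ^ (nu ! j)) * u w)"
      using u unfolding weight_space_def mem_Collect_eq by (elim conjE allE[of _ ?t] mp) simp
    from fun_cong[OF this, of w]
    have "(\<Prod>j<n. ?t j ^ (content n w ! j)) * u w = (\<Prod>j<n. ?t j ^ (nu ! j)) * u w"
      unfolding schur_rep_def if_P[OF U] tensor_power_diag[OF w] .
    then have "(\<Prod>j<n. ?t j ^ (content n w ! j)) = (\<Prod>j<n. ?t j ^ (nu ! j))"
      by (rule iffD1[OF mult_right_cancel[OF nz]])
    moreover have "(\<Prod>j<n. ?t j ^ (a ! j)) = 2 ^ (a ! i)" for a :: "nat list"
    proof -
      have "(\<Prod>j<n. ?t j ^ (a ! j)) = (\<Prod>j<n. if j = i then 2 ^ (a ! i) else 1)"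
        by (intro prod.cong) auto
      then show ?thesis using i by simp
    qed
    ultimately have "(2::complex) ^ (content n w ! i) = 2 ^ (nu ! i)" by (simp only:)
    then have "(of_nat (2 ^ (content n w ! i)) :: complex) = of_nat (2 ^ (nu ! i))"
      by (simp only: of_nat_power of_nat_numeral)
    then have "(2::nat) ^ (content n w ! i) = 2 ^ (nu ! i)" by (simp only: of_nat_eq_iff)
    then show "content n w ! i = nu ! i" by simp
  qed (simp add: nu)
  with U show "u \<in> {u \<in> schur_module n m lam. \<forall>w. u w \<noteq> 0 \<longrightarrow> content n w = nu}" by blast
next
  fix u assume u: "u \<in> {u \<in> schur_module n m lam. \<forall>w. u w \<noteq> 0 \<longrightarrow> content n w = nu}"
  then have U: "u \<in> schur_module n m lam" by simp
  have "tensor_power n m (mat_diag n t) u w = (\<Prod>i<n. t i ^ (nu ! i)) * u w" for t w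
  proof (cases "w \<in> index_words n m")
    case True
    show ?thesis
    proof (cases "u w = 0")
      case False
      then have "content n w = nu" using u by blast
      then show ?thesis by (simp only: tensor_power_diag[OF True])
    qed (simp only: tensor_power_diag[OF True] mult_zero_right)
  next
    case False
    then show ?thesis using schur_module_outside[OF U False] by (simp add: tensor_power_def)
  qed
  then have "tensor_power n m (mat_diag n t) u = (\<lambda>w. (\<Prod>i<n. t i ^ (nu ! i)) * u w)" for t
    by (rule ext)
  then show "u \<in> weight_space n m lam nu"
    using U by (simp add: weight_space_def schur_rep_def)
qed

lemma restrict_content_weight_space:
  assumes "u \<in> schur_module n m lam" "length nu = n"
  shows "restrict_content n nu u \<in> weight_space n m lam nu"
  unfolding weight_space_eq[OF assms(2)]
  using restrict_content_schur_module[OF assms(1)] by (simp add: restrict_content_def)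

text \<open>
  Restriction to words of a fixed content commutes with place permutations and so preserves the Schur
  module. Hence every element is the sum of its restrictions to all contents, which are its
  weight components.
\<close>

lemma weight_projection_eq:
  assumes u: "u \<in> schur_module n m lam" and mu: "length mu = n"
  shows "weight_projection n m lam mu u = restrict_content n mu u"
  unfolding weight_projection_def
proof (rule the_equality, intro conjI)
  let ?X = "\<Union>nu\<in>{nu. length nu = n \<and> nu \<noteq> mu}. weight_space n m lam nu"
  show "restrict_content n mu u \<in> weight_space n m lam mu"
    by (rule restrict_content_weight_space[OF u mu])
  let ?N = "content n ` index_words n m - {mu}"
  (* the remaining contents, of which only finitely many occur in words of length m *)
  have "u - restrict_content n mu u = (\<Sum>nu\<in>?N. restrict_content n nu u)"
  proof
    fix w
    show "(u - restrict_content n mu u) w = (\<Sum>nu\<in>?N. restrict_content n nu u) w"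
    proof (cases "w \<in> index_words n m")
      case True
      have "(\<Sum>nu\<in>?N. restrict_content n nu u w) = (if content n w \<in> ?N then u w else 0)"
        by (simp add: restrict_content_def)
      with True show ?thesis
        by (auto simp: sum_fun_apply restrict_content_def)
    next
      case False
      then show ?thesis
        using schur_module_outside[OF u False] by (simp add: sum_fun_apply restrict_content_def)
    qed
  qed
  moreover have "restrict_content n nu u \<in> ?X" if "nu \<in> ?N" for nu
  proof -
    have "length nu = n" "nu \<noteq> mu" using that by auto
    then show ?thesis using restrict_content_weight_space[OF u, of nu] by blast
  qed
  ultimately show "u - restrict_content n mu u \<in> cfun.span ?X"
    by (simp only:) (intro cfun.span_sum cfun.span_base)
next
  let ?X = "\<Union>nu\<in>{nu. length nu = n \<and> nu \<noteq> mu}. weight_space n m lam nu"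
  fix v assume v: "v \<in> weight_space n m lam mu \<and> u - v \<in> cfun.span ?X"
  let ?P = "\<lambda>x::nat list \<Rightarrow> complex. \<forall>w. content n w = mu \<longrightarrow> x w = 0"
  from v have "u - v \<in> cfun.span ?X" ..
  then have "?P (u - v)"
  proof (rule cfun.span_induct)
    show "cfun.subspace (Collect ?P)"
      by (rule cfun.subspaceI) simp_all
    show "?P x" if "x \<in> ?X" for x
      using that by (auto simp: weight_space_eq)
  qed
  moreover have "content n w = mu" if "v w \<noteq> 0" for w
    using v that by (simp add: weight_space_eq[OF mu])
  ultimately show "v = restrict_content n mu u"
    by (auto simp: restrict_content_def fun_eq_iff)
qed

text \<open>
  On the Schur module \<open>c * d\<close> acts as the identity, so it may be applied after the operator. The
  operator is then given by a kernel whose columns, being images under \<open>c * d\<close>, lie in the Schur module.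
\<close>

lemma trace_weight_space:
  fixes d :: "(nat \<Rightarrow> nat) \<Rightarrow> complex"
  assumes c: "c = young_symmetrizer m lam" and cdc: "ga_mult m (ga_mult m c d) c = c"
    and mu: "length mu = n"
  shows "trace_on (schur_module n m lam)
           (weight_projection n m lam mu \<circ> schur_rep n m lam A \<circ> weight_projection n m lam mu) =
         (\<Sum>w | w \<in> index_words n m \<and> content n w = mu.
            \<Sum>p\<in>perms m. ga_mult m c d p * (\<Prod>k<m. A $$ (w ! p k, w ! k)))"
proof -
  let ?U = "schur_module n m lam" and ?W = "index_words n m" and ?e = "ga_mult m c d"
  let ?T = "weight_projection n m lam mu \<circ> schur_rep n m lam A \<circ> weight_projection n m lam mu"
  define K where "K s w = (if w \<in> ?W \<and> content n w = mu \<and> content n s = mu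
                          then \<Prod>k<m. A $$ (w ! k, s ! k) else 0)" for s w
  have e_fix: "ga_act n m ?e u = u" if u: "u \<in> ?U" for u
  proof -
    obtain f where "u = ga_act n m c f" using u by (auto simp: schur_module_def c)
    then show ?thesis using cdc by (simp flip: ga_act_mult)
  qed
  have T: "?T u = (\<lambda>w. \<Sum>s\<in>?W. u s * ga_act n m ?e (K s) w)" if u: "u \<in> ?U" for u
  proof -
    note Pu = restrict_content_schur_module[OF u, of mu]
    note APu = tensor_power_schur_module[OF Pu, of A]
    let ?g = "restrict_content n mu (tensor_power n m A (restrict_content n mu u))"
    have "?T u = ?g"
      using weight_projection_eq[OF u mu] weight_projection_eq[OF APu mu] Pu by (simp add: schur_rep_def)
    also have "\<dots> = ga_act n m ?e ?g"
      by (rule e_fix[OF restrict_content_schur_module[OF APu], symmetric])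
    also have "?g = (\<lambda>w. \<Sum>s\<in>?W. u s * K s w)"
      by (auto simp: restrict_content_def tensor_power_def K_def fun_eq_iff intro!: sum.cong)
    also have "ga_act n m ?e (\<lambda>w. \<Sum>s\<in>?W. u s * K s w) = (\<lambda>w. \<Sum>s\<in>?W. u s * ga_act n m ?e (K s) w)"
    proof
      fix w
      show "ga_act n m ?e (\<lambda>w. \<Sum>s\<in>?W. u s * K s w) w = (\<Sum>s\<in>?W. u s * ga_act n m ?e (K s) w)"
      proof (cases "w \<in> ?W")
        case True
        have "ga_act n m ?e (\<lambda>w. \<Sum>s\<in>?W. u s * K s w) w =
          (\<Sum>p\<in>perms m. \<Sum>s\<in>?W. ?e p * (u s * K s (permute_list p w)))"
          unfolding ga_act_apply[OF True] sum_distrib_left ..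
        also have "\<dots> = (\<Sum>s\<in>?W. \<Sum>p\<in>perms m. ?e p * (u s * K s (permute_list p w)))"
          by (rule sum.swap)
        also have "\<dots> = (\<Sum>s\<in>?W. u s * ga_act n m ?e (K s) w)"
          unfolding ga_act_apply[OF True] sum_distrib_left by (simp only: mult.left_commute)
        finally show ?thesis .
      qed (simp add: ga_act_outside)
    qed
    finally show ?thesis .
  qed
  have "trace_on ?U ?T = (\<Sum>s\<in>?W. ga_act n m ?e (K s) s)"
  proof (rule trace_on_kernel[where k = "\<lambda>s. ga_act n m ?e (K s)" and S = ?W])
    show "ga_act n m ?e (K s) \<in> ?U" for s
      unfolding ga_act_mult c
      by (rule schur_moduleI) (simp add: tensor_space_def ga_act_outside)
  qed (simp_all only: finite_index_words schur_module_outside subspace_schur_module T not_False_eq_True)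
  also have "\<dots> = (\<Sum>s\<in>?W. if content n s = mu
      then \<Sum>p\<in>perms m. ?e p * (\<Prod>k<m. A $$ (s ! p k, s ! k)) else 0)"
  proof (rule sum.cong[OF refl])
    fix s assume s: "s \<in> ?W"
    have "K s (permute_list p s) = (if content n s = mu then \<Prod>k<m. A $$ (s ! p k, s ! k) else 0)"
      if p: "p permutes {..<m}" for p
    proof -
      have "length s = m" using s by (simp add: index_words_def)
      then have "(\<Prod>k<m. A $$ (permute_list p s ! k, s ! k)) = (\<Prod>k<m. A $$ (s ! p k, s ! k))"
        using p by (intro prod.cong refl) (simp add: permute_list_nth)
      then show ?thesis
        using s p by (simp add: K_def permute_list_index_words content_permute_list)
    qed
    then show "ga_act n m ?e (K s) s = (if content n s = mu
      then \<Sum>p\<in>perms m. ?e p * (\<Prod>k<m. A $$ (s ! p k, s ! k)) else 0)"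
      by (simp add: ga_act_apply[OF s])
  qed
  also have "\<dots> = (\<Sum>w | w \<in> ?W \<and> content n w = mu.
            \<Sum>p\<in>perms m. ?e p * (\<Prod>k<m. A $$ (w ! p k, w ! k)))"
    by (simp add: sum.If_cases Int_def)
  finally show ?thesis .
qed

section \<open>Rearrangements of a word\<close>

text \<open>
  The permutations act transitively on the rearrangements of \<open>xs\<close>, so all fibres of
  \<open>h \<mapsto> permute_list h xs\<close> have the same size \<open>N\<close>. Comparing the total number of permutations with the known
  number of rearrangements identifies \<open>N\<close>.
\<close>

lemma sum_permute_list_eq_sum_permutations_of_multiset:
  fixes \<phi> :: "'a list \<Rightarrow> complex"
  shows "(\<Sum>h\<in>perms (length xs). \<phi> (permute_list h xs)) =
    of_nat (\<Prod>x\<in>set xs. fact (count (mset xs) x)) * (\<Sum>w\<in>permutations_of_multiset (mset xs). \<phi> w)"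
proof -
  let ?G = "perms (length xs)" and ?R = "permutations_of_multiset (mset xs)"
  let ?F = "\<lambda>w. {h \<in> ?G. permute_list h xs = w}"
  define N where "N = card (?F xs)"
  have img: "(\<lambda>h. permute_list h xs) ` ?G = ?R"
  proof (intro equalityI subsetI)
    fix w assume "w \<in> ?R"
    then have "mset w = mset xs" by (rule permutations_of_multisetD)
    then obtain p where "p permutes {..<length xs}" "permute_list p xs = w"
      by (rule mset_eq_permutation)
    then show "w \<in> (\<lambda>h. permute_list h xs) ` ?G" by blast
  qed (auto intro!: permutations_of_multisetI)
  have fibre: "card (?F w) = N" if "w \<in> ?R" for w
  proof -
    obtain g where g: "g permutes {..<length xs}" and w: "w = permute_list g xs"
      using \<open>w \<in> ?R\<close> unfolding img[symmetric] by auto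
    have comp: "permute_list (h \<circ> f) xs = permute_list f (permute_list h xs)"
      if "f permutes {..<length xs}" for f h
      using that by (rule permute_list_compose)
    have "bij_betw (\<lambda>h. h \<circ> g) (?F xs) (?F w)"
    proof (rule bij_betw_byWitness[where f' = "\<lambda>h. h \<circ> pinv g"])
      show "\<forall>h\<in>?F xs. (h \<circ> g) \<circ> pinv g = h" "\<forall>h\<in>?F w. (h \<circ> pinv g) \<circ> g = h"
        by (simp_all only: permutes_comp_cancel[OF g] ball_triv simp_thms)
      show "(\<lambda>h. h \<circ> g) ` ?F xs \<subseteq> ?F w"
        using g by (auto simp: comp w intro: permutes_compose)
      have "permute_list (pinv g) w = xs"
        using comp[OF permutes_inv[OF g], of g] permutes_inv_o(1)[OF g] w by simp
      then show "(\<lambda>h. h \<circ> pinv g) ` ?F w \<subseteq> ?F xs"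
        using comp[OF permutes_inv[OF g]] permutes_compose[OF permutes_inv[OF g]] by fastforce
    qed
    then show ?thesis unfolding N_def by (rule bij_betw_same_card[symmetric])
  qed
  have sum: "(\<Sum>h\<in>?G. \<psi> (permute_list h xs)) = of_nat N * (\<Sum>w\<in>?R. \<psi> w)"
    for \<psi> :: "'a list \<Rightarrow> complex"
  proof -
    have "(\<Sum>h\<in>?G. \<psi> (permute_list h xs)) = (\<Sum>w\<in>?R. \<Sum>h\<in>?F w. \<psi> (permute_list h xs))"
      using sum.image_gen[of ?G "\<lambda>h. \<psi> (permute_list h xs)" "\<lambda>h. permute_list h xs"] img by simp
    also have "\<dots> = (\<Sum>w\<in>?R. of_nat N * \<psi> w)"
      using fibre by (intro sum.cong refl) simp
    finally show ?thesis by (simp add: sum_distrib_left)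
  qed
  have "card ?R * (\<Prod>x\<in>set xs. fact (count (mset xs) x)) = fact (length xs)"
    using card_permutations_of_multiset_aux[of "mset xs"] by simp
  moreover have "of_nat (fact (length xs)) = (of_nat (N * card ?R) :: complex)"
    using sum[of "\<lambda>_. 1"] by (simp add: card_permutations)
  ultimately have "N * card ?R = (\<Prod>x\<in>set xs. fact (count (mset xs) x)) * card ?R"
    by (metis of_nat_eq_iff mult.commute)
  moreover have "card ?R \<noteq> 0"
    using card_permutations_of_multiset_aux[of "mset xs"] by (metis fact_nonzero mult_zero_left)
  ultimately have "N = (\<Prod>x\<in>set xs. fact (count (mset xs) x))" by simp
  with sum show ?thesis by simp
qed

lemma count_composition_mset:
  "count (composition_mset mu) j = (if j < length mu then mu ! j else 0)"
  by (simp add: composition_mset_def count_sum)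

lemma size_composition_mset: "size (composition_mset mu) = sum_list mu"
proof -
  have "size (\<Sum>j<k. replicate_mset (mu ! j) j) = (\<Sum>j<k. mu ! j)" for k
    by (induction k) simp_all
  then show ?thesis
    by (simp add: composition_mset_def sum_list_sum_nth atLeast0LessThan)
qed

lemma words_of_content:
  assumes "weak_composition n m mu"
  shows "{w \<in> index_words n m. content n w = mu} = permutations_of_multiset (composition_mset mu)"
proof (intro Set.set_eqI)
  fix w
  have mu: "length mu = n" "sum_list mu = m" using assms by (auto simp: weak_composition_def)
  have "mset w = composition_mset mu \<longleftrightarrow> w \<in> index_words n m \<and> content n w = mu"
  proof
    assume w: "mset w = composition_mset mu"
    then have "length w = m" by (metis size_mset size_composition_mset mu(2))
    moreover have "set w \<subseteq> {..<n}"
    proof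
      fix j assume "j \<in> set w"
      then have "count (mset w) j \<noteq> 0" by simp
      then show "j \<in> {..<n}"
        using mu(1) unfolding w count_composition_mset by (simp split: if_splits)
    qed
    moreover have "content n w = mu"
      by (rule nth_equalityI) (simp_all add: content_def w count_composition_mset mu(1))
    ultimately show "w \<in> index_words n m \<and> content n w = mu" by (simp add: index_words_def)
  next
    assume w: "w \<in> index_words n m \<and> content n w = mu"
    show "mset w = composition_mset mu"
    proof (rule multiset_eqI)
      fix j
      show "count (mset w) j = count (composition_mset mu) j"
      proof (cases "j < n")
        case True
        then have "count (mset w) j = content n w ! j" by (simp add: content_def)
        with w True show ?thesis by (simp add: count_composition_mset mu(1))
      next
        case False
        then have "j \<notin> set w" using w by (auto simp: index_words_def)
        then show ?thesis using False by (simp add: count_composition_mset mu(1))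
      qed
    qed
  qed
  then show "w \<in> {w \<in> index_words n m. content n w = mu} \<longleftrightarrow> w \<in> permutations_of_multiset (composition_mset mu)"
    by (simp add: permutations_of_multiset_def)
qed

section \<open>The immanant as a trace\<close>

text \<open>
  Substitute \<open>g = h p h\<inverse>\<close> in the sum and \<open>k \<mapsto> h k\<close> in the product.
\<close>

lemma sum_conjugate_permute_list:
  fixes e :: "(nat \<Rightarrow> nat) \<Rightarrow> complex"
  assumes len: "length xs = m" and h: "h permutes {..<m}"
  shows "(\<Sum>p\<in>perms m. e p * (\<Prod>k<m. A $$ (permute_list h xs ! p k, permute_list h xs ! k))) =
    (\<Sum>g\<in>perms m. e (pinv h \<circ> g \<circ> h) * (\<Prod>k<m. A $$ (xs ! g k, xs ! k)))"
proof -
  let ?F = "\<lambda>g. e (pinv h \<circ> g \<circ> h) * (\<Prod>k<m. A $$ (xs ! g k, xs ! k))"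
  have "(\<Sum>p\<in>perms m. e p * (\<Prod>k<m. A $$ (permute_list h xs ! p k, permute_list h xs ! k)))
      = (\<Sum>p\<in>perms m. ?F (h \<circ> (p \<circ> pinv h)))"
  proof (rule sum.cong[OF refl])
    fix p assume "p \<in> perms m"
    then have p: "p permutes {..<m}" by simp
    have lt: "p k < m" if "k < m" for k using permutes_in_image[OF p, of k] that by simp
    have "(\<Prod>k<m. A $$ (permute_list h xs ! p k, permute_list h xs ! k)) = (\<Prod>k<m. A $$ (xs ! h (p k), xs ! h k))"
      using len h lt by (intro prod.cong refl) (simp add: permute_list_nth)
    also have "\<dots> = (\<Prod>k<m. A $$ (xs ! (h \<circ> (p \<circ> pinv h)) k, xs ! k))"
      using prod.permute[OF h, of "\<lambda>k. A $$ (xs ! (h \<circ> (p \<circ> pinv h)) k, xs ! k)"]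
      by (simp add: comp_def permutes_inverses[OF h])
    moreover have "pinv h \<circ> (h \<circ> (p \<circ> pinv h)) \<circ> h = p"
      unfolding permutes_comp_cancel[OF h] ..
    ultimately show "e p * (\<Prod>k<m. A $$ (permute_list h xs ! p k, permute_list h xs ! k)) = ?F (h \<circ> (p \<circ> pinv h))"
      by simp
  qed
  also have "\<dots> = (\<Sum>p\<in>perms m. ?F (h \<circ> p))"
    by (rule sum_perms_right[OF permutes_inv[OF h]])
  also have "\<dots> = (\<Sum>g\<in>perms m. ?F g)"
    by (rule sum_perms_left[OF h])
  finally show ?thesis .
qed

theorem theorem2p3:
  fixes n m :: nat and lam mu :: "nat list" and I :: "nat multiset" and A :: "complex mat"
  assumes "n \<ge> 1" and "m \<ge> 1"
    and "partition_of m lam"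
    and "weak_composition n m mu"
    and "I = composition_mset mu"
    and "A \<in> carrier_mat n n"
  shows "immanant (irr_char m lam) (gen_principal_submatrix A I) / of_nat (\<Prod>j<n. fact (mu ! j)) =
         trace_on (schur_module n m lam)
           (weight_projection n m lam mu \<circ> schur_rep n m lam A \<circ> weight_projection n m lam mu)"
proof -
  define c where "c = young_symmetrizer m lam"
  obtain d where d: "d \<in> group_algebra m" "ga_mult m (ga_mult m c d) c = c"
    "ga_star m (ga_mult m c d) = ga_mult m c d"
    using young_symmetrizer_quasi_inverse[of m lam] unfolding c_def by blast
  let ?e = "ga_mult m c d"
  define xs where "xs = sorted_list_of_multiset I"
  have mu: "length mu = n" "sum_list mu = m"
    using assms(4) by (simp_all add: weak_composition_def)
  have xs: "mset xs = I" by (simp add: xs_def)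
  have size: "size I = m" by (simp add: assms(5) size_composition_mset mu)
  then have len: "length xs = m" using xs by (metis size_mset)
  let ?\<phi> = "\<lambda>w. \<Sum>p\<in>perms m. ?e p * (\<Prod>k<m. A $$ (w ! p k, w ! k))"

  have fact: "(\<Prod>x\<in>set xs. fact (count (mset xs) x)) = (\<Prod>j<n. fact (mu ! j) :: nat)"
  proof -
    have "(\<Prod>x\<in>set xs. fact (count (mset xs) x)) = (\<Prod>j<n. fact (count (mset xs) j) :: nat)"
    proof (rule prod.mono_neutral_left)
      show "set xs \<subseteq> {..<n}"
        using words_of_content[OF assms(4)] xs assms(5)
        by (auto simp: permutations_of_multiset_def index_words_def)
      show "\<forall>j\<in>{..<n} - set xs. fact (count (mset xs) j) = (1 :: nat)"
      proof
        fix j assume "j \<in> {..<n} - set xs"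
        then have "count (mset xs) j = 0" by simp
        then show "fact (count (mset xs) j) = (1 :: nat)" by (simp only: fact_0)
      qed
    qed simp
    also have "\<dots> = (\<Prod>j<n. fact (mu ! j))"
      unfolding xs assms(5) count_composition_mset mu(1) by (intro prod.cong) simp_all
    finally show ?thesis .
  qed
  have "immanant (irr_char m lam) (gen_principal_submatrix A I)
      = (\<Sum>g\<in>perms m. irr_char m lam g * (\<Prod>k<m. A $$ (xs ! g k, xs ! k)))"
  proof -
    have entry: "mat m m (\<lambda>(r, s). A $$ (xs ! r, xs ! s)) $$ (g k, k) = A $$ (xs ! g k, xs ! k)"
      if "g permutes {..<m}" "k < m" for g k
      using that permutes_in_image[OF that(1), of k] by simp
    show ?thesis
      unfolding immanant_def gen_principal_submatrix_def Let_def xs_def[symmetric] size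
      using entry by (intro sum.cong) simp_all
  qed
  also have "\<dots> = (\<Sum>g\<in>perms m. \<Sum>h\<in>perms m. ?e (pinv h \<circ> g \<circ> h) * (\<Prod>k<m. A $$ (xs ! g k, xs ! k)))"
  proof (rule sum.cong[OF refl])
    fix g assume "g \<in> perms m"
    then have "irr_char m lam g = (\<Sum>h\<in>perms m. ?e (pinv h \<circ> g \<circ> h))"
      by (intro irr_char_eq_conjugation_sum[OF d(1) c_def d(2,3)]) simp
    then show "irr_char m lam g * (\<Prod>k<m. A $$ (xs ! g k, xs ! k))
        = (\<Sum>h\<in>perms m. ?e (pinv h \<circ> g \<circ> h) * (\<Prod>k<m. A $$ (xs ! g k, xs ! k)))"
      by (simp only: sum_distrib_right)
  qed
  also have "\<dots> = (\<Sum>h\<in>perms m. \<Sum>g\<in>perms m. ?e (pinv h \<circ> g \<circ> h) * (\<Prod>k<m. A $$ (xs ! g k, xs ! k)))"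
    by (rule sum.swap)
  also have "\<dots> = (\<Sum>h\<in>perms m. ?\<phi> (permute_list h xs))"
    by (rule sum.cong[OF refl], rule sum_conjugate_permute_list[OF len, symmetric]) simp
  also have "\<dots> = of_nat (\<Prod>j<n. fact (mu ! j)) * (\<Sum>w\<in>permutations_of_multiset I. ?\<phi> w)"
    using sum_permute_list_eq_sum_permutations_of_multiset[of ?\<phi> xs] unfolding len xs fact[unfolded xs] .
  also have "(\<Sum>w\<in>permutations_of_multiset I. ?\<phi> w) =
     trace_on (schur_module n m lam)
           (weight_projection n m lam mu \<circ> schur_rep n m lam A \<circ> weight_projection n m lam mu)"
    unfolding trace_weight_space[OF c_def d(2) mu(1)] assms(5) words_of_content[OF assms(4), symmetric] ..
  finally show ?thesis by simp
qed

end
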